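(* Let $n\ge1$ be an integer, $0<m<1$, $R>0$, $\mathfrak m>0$, and let $V\in W^{2,\infty}(B_R)$ be radially symmetric and increasing in $|x|$ with $V(0)=0$. Then any sequence $\rho_j$ minimising $\mathcal F_R$ over $\mathcal P_{\mathfrak m}(\overline{B_R})\cap L^1(B_R)$ converges weakly-$\star$ in the sense of measures to $$\mu_{\infty,\mathfrak m}=\begin{cases}\rho_{V+h} & \text{if there is } h\ge0\text{ such that }a_{V+h,R}=\mathfrak m,\\ (\mathfrak m-a_{V,R})\delta_0+\rho_V&\text{if }a_{V,R}<\mathfrak m.\end{cases}$$ Furthermore, $$\widetilde{\mathcal F}_R[\mu_{\infty,\mathfrak m}]=\inf_{\mu\in\mathcal P_{\mathfrak m}(\overline{B_R})}\widetilde{\mathcal F}_R[\mu]=\inf_{\rho\in\mathcal P_{\mathfrak m}(\overline{B_R})\cap L^1(B_R)}\mathcal F_R[\rho].$$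
   Context: $B_R\subset\mathbb R^n$ is the open ball of radius $R$ centred at $0$. For $h\ge0$, $\rho_{V+h}(x)=\left(\tfrac{1-m}{m}(V(x)+h)\right)^{-\frac1{1-m}}$ and $a_{V+h,R}=\int_{B_R}\rho_{V+h}\,dx\in(0,\infty]$. $\mathcal P_{\mathfrak m}(\overline{B_R})$ is the set of nonnegative Borel measures on $\overline{B_R}$ of total mass $\mathfrak m$; $L^1$ functions are identified with absolutely continuous measures. For nonnegative $\rho\in L^1(B_R)$, $\mathcal F_R[\rho]=\tfrac1{m-1}\int_{B_R}\rho^m\,dx+\int_{B_R}V\rho\,dx$. For a nonnegative measure $\mu$ on $\overline{B_R}$ with absolutely continuous part $\mu_{ac}$ (identified with its density), $\widetilde{\mathcal F}_R[\mu]=-\tfrac1{1-m}\int_{B_R}\mu_{ac}^m\,dx+\int_{\overline{B_R}}V\,d\mu$. A minimising sequence is one with $\mathcal F_R[\rho_j]\to\inf\mathcal F_R$ over the stated set. *)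

theory Defs
  imports "HOL-Probability.Probability"
begin

definition partial_deriv :: "'a::euclidean_space \<Rightarrow> ('a \<Rightarrow> real) \<Rightarrow> 'a \<Rightarrow> real" where
  "partial_deriv i \<phi> x = frechet_derivative \<phi> (at x) i"

text \<open>A list of basis vectors plays the role of a multi-index.\<close>

primrec iter_partial :: "'a::euclidean_space list \<Rightarrow> ('a \<Rightarrow> real) \<Rightarrow> 'a \<Rightarrow> real" where
  "iter_partial [] \<phi> = \<phi>"
| "iter_partial (i # is) \<phi> = partial_deriv i (iter_partial is \<phi>)"

text \<open>Smoothness: every iterated partial derivative is again (Frechet) differentiable everywhere,
  hence in particular continuous.\<close>

definition smooth :: "('a::euclidean_space \<Rightarrow> real) \<Rightarrow> bool" where
  "smooth \<phi> \<longleftrightarrow> (\<forall>is. set is \<subseteq> Basis \<longrightarrow> iter_partial is \<phi> differentiable_on UNIV)"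

definition test_function :: "'a::euclidean_space set \<Rightarrow> ('a \<Rightarrow> real) \<Rightarrow> bool" where
  "test_function \<Omega> \<phi> \<longleftrightarrow> smooth \<phi> \<and> compact (closure {x. \<phi> x \<noteq> 0}) \<and> closure {x. \<phi> x \<noteq> 0} \<subseteq> \<Omega>"

definition Linf_on :: "'a::euclidean_space set \<Rightarrow> ('a \<Rightarrow> real) \<Rightarrow> bool" where
  "Linf_on \<Omega> u \<longleftrightarrow> set_borel_measurable lborel \<Omega> u \<and> (\<exists>C. AE x\<in>\<Omega> in lborel. \<bar>u x\<bar> \<le> C)"

definition weak_deriv ::
    "'a::euclidean_space set \<Rightarrow> 'a list \<Rightarrow> ('a \<Rightarrow> real) \<Rightarrow> ('a \<Rightarrow> real) \<Rightarrow> bool" where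
  "weak_deriv \<Omega> is u g \<longleftrightarrow>
     (\<forall>\<phi>. test_function \<Omega> \<phi> \<longrightarrow>
        (LINT x:\<Omega>|lborel. u x * iter_partial is \<phi> x) =
          (-1) ^ length is * (LINT x:\<Omega>|lborel. g x * \<phi> x))"

text \<open>This only depends on the almost-everywhere class of \<open>u\<close>. On a ball each such class with
  \<open>k \<ge> 1\<close> has a unique representative that is continuous up to the boundary. Pointwise conditions
  on \<open>V\<close> and integrals over the closed ball refer to that representative, which is why
  \<open>V\<close> is separately taken to be continuous on the closed ball.\<close>

definition sobolev_inf :: "nat \<Rightarrow> 'a::euclidean_space set \<Rightarrow> ('a \<Rightarrow> real) \<Rightarrow> bool" where
  "sobolev_inf k \<Omega> u \<longleftrightarrow>
     Linf_on \<Omega> u \<and>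
     (\<forall>is. set is \<subseteq> Basis \<and> length is \<le> k \<longrightarrow> (\<exists>g. Linf_on \<Omega> g \<and> weak_deriv \<Omega> is u g))"

text \<open>``Increasing'' is read as nondecreasing, which includes the strictly increasing case.\<close>

definition radially_increasing :: "real \<Rightarrow> ('a::euclidean_space \<Rightarrow> real) \<Rightarrow> bool" where
  "radially_increasing R V \<longleftrightarrow>
     (\<exists>v. mono_on {0..<R} v \<and> (\<forall>x\<in>ball 0 R. V x = v (norm x)))"

definition lebesgue_cball :: "real \<Rightarrow> 'a::euclidean_space measure" where
  "lebesgue_cball R = restrict_space lborel (cball 0 R)"

definition mass_measures :: "real \<Rightarrow> real \<Rightarrow> 'a::euclidean_space measure set" where
  "mass_measures R mass =
     {\<mu>. sets \<mu> = sets (restrict_space borel (cball 0 R)) \<and> emeasure \<mu> (space \<mu>) = ennreal mass}"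

text \<open>The absolutely continuous measure identified with a density on the open ball
  (the bounding sphere is a Lebesgue null set).\<close>

definition density_measure :: "real \<Rightarrow> ('a::euclidean_space \<Rightarrow> ennreal) \<Rightarrow> 'a measure" where
  "density_measure R f = density (lebesgue_cball R) (\<lambda>x. indicator (ball 0 R) x * f x)"

definition mass_densities :: "real \<Rightarrow> real \<Rightarrow> ('a::euclidean_space \<Rightarrow> real) set" where
  "mass_densities R mass =
     {\<rho>. set_integrable lborel (ball 0 R) \<rho> \<and> (AE x\<in>ball 0 R in lborel. 0 \<le> \<rho> x) \<and>
         density_measure R (\<lambda>x. ennreal (\<rho> x)) \<in> mass_measures R mass}"

definition add_measure :: "'a measure \<Rightarrow> 'a measure \<Rightarrow> 'a measure" where
  "add_measure \<mu> \<nu> = measure_of (space \<mu>) (sets \<mu>) (\<lambda>A. emeasure \<mu> A + emeasure \<nu> A)"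

lemma sets_add_measure [simp]: "sets (add_measure \<mu> \<nu>) = sets \<mu>"
  by (simp add: add_measure_def)

lemma space_add_measure [simp]: "space (add_measure \<mu> \<nu>) = space \<mu>"
  by (simp add: add_measure_def)

lemma emeasure_add_measure:
  assumes "sets \<nu> = sets \<mu>" "A \<in> sets \<mu>"
  shows "emeasure (add_measure \<mu> \<nu>) A = emeasure \<mu> A + emeasure \<nu> A"
proof (rule emeasure_measure_of[OF add_measure_def])
  show "countably_additive (sets (add_measure \<mu> \<nu>)) (\<lambda>A. emeasure \<mu> A + emeasure \<nu> A)"
  proof (rule countably_additiveI)
    fix F :: "nat \<Rightarrow> 'a set"
    assume "range F \<subseteq> sets (add_measure \<mu> \<nu>)" "disjoint_family F"
    then show "(\<Sum>i. emeasure \<mu> (F i) + emeasure \<nu> (F i)) =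
        emeasure \<mu> (\<Union>i. F i) + emeasure \<nu> (\<Union>i. F i)"
      using assms(1) by (simp add: suminf_add[symmetric] suminf_emeasure)
  qed
qed (use assms sets.space_closed in \<open>auto simp: positive_def\<close>)

definition mutually_singular :: "'a measure \<Rightarrow> 'a measure \<Rightarrow> bool" where
  "mutually_singular L \<sigma> \<longleftrightarrow> (\<exists>N\<in>null_sets L. emeasure \<sigma> (space \<sigma> - N) = 0)"

text \<open>The Lebesgue decomposition exists and is unique for the finite measures considered here.\<close>

definition ac_part :: "real \<Rightarrow> 'a::euclidean_space measure \<Rightarrow> 'a measure" where
  "ac_part R \<mu> =
     (THE \<alpha>. sets \<alpha> = sets \<mu> \<and> absolutely_continuous (lebesgue_cball R) \<alpha> \<and>
        (\<exists>\<sigma>. sets \<sigma> = sets \<mu> \<and> mutually_singular (lebesgue_cball R) \<sigma> \<and> \<mu> = add_measure \<alpha> \<sigma>))"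

definition ac_density :: "real \<Rightarrow> 'a::euclidean_space measure \<Rightarrow> 'a \<Rightarrow> real" where
  "ac_density R \<mu> x = enn2real (RN_deriv (lebesgue_cball R) (ac_part R \<mu>) x)"

text \<open>The test functions are all continuous functions on the closed ball (a compact set).\<close>

definition weak_star_conv ::
    "real \<Rightarrow> (nat \<Rightarrow> 'a::euclidean_space measure) \<Rightarrow> 'a measure \<Rightarrow> bool" where
  "weak_star_conv R \<mu>s \<mu> \<longleftrightarrow>
     (\<forall>f::'a \<Rightarrow> real. continuous_on (cball 0 R) f \<longrightarrow>
        (\<lambda>j. integral\<^sup>L (\<mu>s j) f) \<longlonglongrightarrow> integral\<^sup>L \<mu> f)"

definition F_fun :: "real \<Rightarrow> ('a::euclidean_space \<Rightarrow> real) \<Rightarrow> real \<Rightarrow> ('a \<Rightarrow> real) \<Rightarrow> real" where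
  "F_fun m V R \<rho> =
     1 / (m - 1) * (LINT x:ball 0 R|lborel. \<rho> x powr m) + (LINT x:ball 0 R|lborel. V x * \<rho> x)"

definition F_relaxed ::
    "real \<Rightarrow> ('a::euclidean_space \<Rightarrow> real) \<Rightarrow> real \<Rightarrow> 'a measure \<Rightarrow> real" where
  "F_relaxed m V R \<mu> =
     - (1 / (1 - m)) * (LINT x:ball 0 R|lborel. ac_density R \<mu> x powr m) + integral\<^sup>L \<mu> V"

text \<open>Extended-valued, because \<open>0 powr a = 0\<close> in the library, whereas the
  negative power here is infinite where \<open>V + h\<close> vanishes.\<close>

definition rho :: "real \<Rightarrow> ('a::euclidean_space \<Rightarrow> real) \<Rightarrow> real \<Rightarrow> 'a \<Rightarrow> ennreal" where
  "rho m V h x =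
     (if V x + h = 0 then \<infinity> else ennreal (((1 - m) / m * (V x + h)) powr (- (1 / (1 - m)))))"

definition a_mass :: "real \<Rightarrow> ('a::euclidean_space \<Rightarrow> real) \<Rightarrow> real \<Rightarrow> real \<Rightarrow> ennreal" where
  "a_mass m V R h = (\<integral>\<^sup>+x\<in>ball 0 R. rho m V h x \<partial>lborel)"

text \<open>The last branch is left unspecified: that the two cases are exhaustive, and that \<open>h\<close> is
  unique, is part of what has to be shown about this measure.\<close>

definition mu_inf ::
    "real \<Rightarrow> ('a::euclidean_space \<Rightarrow> real) \<Rightarrow> real \<Rightarrow> real \<Rightarrow> 'a measure" where
  "mu_inf m V R mass =
     (if \<exists>h\<ge>0. a_mass m V R h = ennreal mass
        then density_measure R (rho m V (THE h. 0 \<le> h \<and> a_mass m V R h = ennreal mass))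
      else if a_mass m V R 0 < ennreal mass
        then add_measure
          (scale_measure (ennreal mass - a_mass m V R 0) (return (lebesgue_cball R) 0))
          (density_measure R (rho m V 0))
      else undefined)"

end

theory Submission
  imports Defs
begin

text \<open>
  Put \<open>G\<^sub>w(s) = - s\<^sup>m / (1 - m) + w s\<close>. For \<open>w > 0\<close> it is minimised over \<open>s \<ge> 0\<close> exactly at
  \<open>((1 - m) / m * w) powr (- 1 / (1 - m))\<close>, so \<open>\<rho>\<^bsub>V+h\<^esub>\<close> minimises
  \<open>\<integral> G\<^bsub>V+h\<^esub>(\<rho>)\<close> pointwise. Choose \<open>h \<ge> 0\<close> with \<open>a\<^bsub>V+h\<^esub> = mass\<close>, or \<open>h = 0\<close> if
  \<open>a\<^bsub>V\<^esub> < mass\<close>; as the mass is prescribed, adding \<open>h\<close> to \<open>V\<close> shifts the energy by a constant, and a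
  Dirac mass at the origin is free because \<open>V(0) = 0\<close>. Hence the minimal energy is that of
  \<open>\<rho>\<^bsub>V+h\<^esub>\<close>, and the integral of the pointwise gap
  \<open>G\<^bsub>V+h\<^esub>(\<rho>\<^sub>j) - G\<^bsub>V+h\<^esub>(\<rho>\<^bsub>V+h\<^esub>)\<close> tends to 0 along a minimising sequence. Away from the origin,
  where \<open>V + h\<close> is bounded below, the gap controls \<open>\<bar>\<rho>\<^sub>j - \<rho>\<^bsub>V+h\<^esub>\<bar>\<close>; near the origin a test function
  is nearly constant, so only the total mass matters there.
\<close>

subsection \<open>Sums of measures and the Lebesgue decomposition\<close>

text \<open>Induction over nonnegative measurable functions: indicators reduce to
  \<open>emeasure_add_measure\<close>, and suprema of increasing sequences pass through both
  summands by monotone convergence.\<close>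

lemma nn_integral_add_measure:
  assumes [simp]: "sets \<nu> = sets \<mu>" and f: "f \<in> borel_measurable \<mu>"
  shows "(\<integral>\<^sup>+x. f x \<partial>add_measure \<mu> \<nu>) = (\<integral>\<^sup>+x. f x \<partial>\<mu>) + (\<integral>\<^sup>+x. f x \<partial>\<nu>)"
proof -
  note [simp] = sets_eq_imp_space_eq[OF assms(1)]
  have m: "g \<in> borel_measurable (add_measure \<mu> \<nu>)" "g \<in> borel_measurable \<nu>"
    if "g \<in> borel_measurable \<mu>" for g :: "'a \<Rightarrow> ennreal"
    using that by (simp_all add: measurable_def)
  show ?thesis
    using f
  proof induct
    case (cong f g)
    then show ?case
      by (simp cong: nn_integral_cong_simp)
  next
    case (set A)
    then show ?case
      by (simp add: emeasure_add_measure)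
  next
    case (mult u c)
    then show ?case
      by (simp add: nn_integral_cmult m distrib_left)
  next
    case (add u v)
    then show ?case
      by (simp add: nn_integral_add m ac_simps)
  next
    case (seq U)
    note U = seq(1) and U' = m[OF seq(1)] and inc = \<open>incseq U\<close>
    note IH = seq(3)
    have "(\<integral>\<^sup>+x. (SUP i. U i x) \<partial>add_measure \<mu> \<nu>) = (SUP i. integral\<^sup>N (add_measure \<mu> \<nu>) (U i))"
      by (intro nn_integral_monotone_convergence_SUP inc U')
    also have "\<dots> = (SUP i. integral\<^sup>N \<mu> (U i) + integral\<^sup>N \<nu> (U i))"
      by (simp only: IH)
    also have "\<dots> = (SUP i. integral\<^sup>N \<mu> (U i)) + (SUP i. integral\<^sup>N \<nu> (U i))"
      by (intro ennreal_SUP_add incseq_nn_integral inc)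
    also have "(SUP i. integral\<^sup>N \<mu> (U i)) = (\<integral>\<^sup>+x. (SUP i. U i x) \<partial>\<mu>)"
      by (intro nn_integral_monotone_convergence_SUP[symmetric] inc U)
    also have "(SUP i. integral\<^sup>N \<nu> (U i)) = (\<integral>\<^sup>+x. (SUP i. U i x) \<partial>\<nu>)"
      by (intro nn_integral_monotone_convergence_SUP[symmetric] inc U')
    finally show ?case
      by (simp add: image_comp)
  qed
qed

text \<open>As \<open>ennreal\<close> truncates negative reals to 0, \<open>ennreal (f x)\<close>
  and \<open>ennreal (- f x)\<close> are the positive and negative parts of \<open>f\<close>. Each
  has finite integral against both measures, so the nonnegative case can be applied twice and
  subtracted.\<close>

lemma integral_add_measure:
  fixes f :: "'a \<Rightarrow> real"
  assumes [simp]: "sets \<nu> = sets \<mu>" and "integrable \<mu> f" "integrable \<nu> f"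
  shows "integrable (add_measure \<mu> \<nu>) f"
    and "integral\<^sup>L (add_measure \<mu> \<nu>) f = integral\<^sup>L \<mu> f + integral\<^sup>L \<nu> f"
proof -
  note [simp] = sets_eq_imp_space_eq[OF assms(1)]
  have [measurable]: "f \<in> borel_measurable \<mu>" "f \<in> borel_measurable \<nu>"
    using assms by auto
  have m: "f \<in> borel_measurable (add_measure \<mu> \<nu>)"
    using assms(2) borel_measurable_integrable by (simp add: measurable_def)
  have split: "(\<integral>\<^sup>+x. ennreal (g x) \<partial>add_measure \<mu> \<nu>)
      = (\<integral>\<^sup>+x. ennreal (g x) \<partial>\<mu>) + (\<integral>\<^sup>+x. ennreal (g x) \<partial>\<nu>)"
    if "g \<in> borel_measurable \<mu>" for g
    using that by (intro nn_integral_add_measure) auto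
  have split_f: "(\<integral>\<^sup>+x. ennreal (f x) \<partial>add_measure \<mu> \<nu>)
      = (\<integral>\<^sup>+x. ennreal (f x) \<partial>\<mu>) + (\<integral>\<^sup>+x. ennreal (f x) \<partial>\<nu>)"
    and split_mf: "(\<integral>\<^sup>+x. ennreal (- f x) \<partial>add_measure \<mu> \<nu>)
      = (\<integral>\<^sup>+x. ennreal (- f x) \<partial>\<mu>) + (\<integral>\<^sup>+x. ennreal (- f x) \<partial>\<nu>)"
    by (intro split; measurable)+
  have fin: "(\<integral>\<^sup>+x. ennreal (f x) \<partial>\<kappa>) < top" "(\<integral>\<^sup>+x. ennreal (- f x) \<partial>\<kappa>) < top"
    if "integrable \<kappa> f" for \<kappa>
    using that real_integrable_def[of \<kappa> f] by (simp_all add: less_top)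
  note fin1 = fin[OF assms(2)] fin[OF assms(3)]
  show int: "integrable (add_measure \<mu> \<nu>) f"
    unfolding real_integrable_def split_f split_mf
    using m fin1 by (auto simp only: ennreal_add_eq_top infinity_ennreal_def less_irrefl)
  show "integral\<^sup>L (add_measure \<mu> \<nu>) f = integral\<^sup>L \<mu> f + integral\<^sup>L \<nu> f"
    unfolding real_lebesgue_integral_def[OF int] real_lebesgue_integral_def[OF assms(2)]
      real_lebesgue_integral_def[OF assms(3)] split_f split_mf
      enn2real_plus[OF fin1(1) fin1(3)] enn2real_plus[OF fin1(2) fin1(4)] by simp
qed

section \<open>Uniqueness and existence of the Lebesgue decomposition\<close>

definition lebesgue_split :: "'a measure \<Rightarrow> 'a measure \<Rightarrow> 'a measure \<Rightarrow> 'a measure \<Rightarrow> bool" where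
  "lebesgue_split L \<mu> \<alpha> \<sigma> \<longleftrightarrow> sets \<alpha> = sets \<mu> \<and> absolutely_continuous L \<alpha> \<and>
     sets \<sigma> = sets \<mu> \<and> mutually_singular L \<sigma> \<and> \<mu> = add_measure \<alpha> \<sigma>"

text \<open>The part \<alpha> ignores null sets and \<sigma> lives on \<open>N\<close>, so cutting
  out a null set that contains \<open>N\<close> recovers \<alpha> from \<mu>. Allowing every larger
  null set \<open>N'\<close> makes it possible to treat two decompositions with the same
  set.\<close>

lemma lebesgue_split_emeasure:
  assumes sp: "lebesgue_split L \<mu> \<alpha> \<sigma>" and L: "sets L = sets \<mu>"
  shows "\<exists>N\<in>null_sets L. \<forall>N'\<in>null_sets L. \<forall>A\<in>sets \<mu>.
    N \<subseteq> N' \<longrightarrow> emeasure \<alpha> A = emeasure \<mu> (A - N')"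
proof -
  from sp have s[simp]: "sets \<alpha> = sets \<mu>" "sets \<sigma> = sets \<mu>"
    and ac: "absolutely_continuous L \<alpha>" and \<mu>: "\<mu> = add_measure \<alpha> \<sigma>"
    and sing: "mutually_singular L \<sigma>"
    unfolding lebesgue_split_def by blast+
  from sing obtain N where N: "N \<in> null_sets L" "emeasure \<sigma> (space \<sigma> - N) = 0"
    by (auto simp: mutually_singular_def)
  have main: "emeasure \<alpha> A = emeasure \<mu> (A - N')"
    if N': "N' \<in> null_sets L" "N \<subseteq> N'" and A: "A \<in> sets \<mu>" for N' A
  proof -
    have [simp]: "N' \<in> sets \<mu>" "N \<in> sets \<mu>" using N' N L by auto
    have "emeasure \<alpha> A = emeasure \<alpha> (A - N')"
      using ac N' A by (intro emeasure_Diff_null_set[symmetric]) (auto simp: absolutely_continuous_def)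
    moreover have "emeasure \<sigma> (A - N') \<le> emeasure \<sigma> (space \<sigma> - N)"
      using N' A sets.sets_into_space[OF A] sets_eq_imp_space_eq[OF s(2)] by (intro emeasure_mono) auto
    then have "emeasure \<sigma> (A - N') = 0" using N by simp
    moreover have "emeasure \<mu> (A - N') = emeasure \<alpha> (A - N') + emeasure \<sigma> (A - N')"
      using A by (subst \<mu>, intro emeasure_add_measure) auto
    ultimately show ?thesis by simp
  qed
  show ?thesis by (intro bexI[OF _ N(1)] ballI impI main)
qed

lemma lebesgue_split_unique:
  assumes "lebesgue_split L \<mu> \<alpha> \<sigma>" "lebesgue_split L \<mu> \<alpha>' \<sigma>'" and L: "sets L = sets \<mu>"
  shows "\<alpha> = \<alpha>'"
proof (rule measure_eqI)
  have s: "sets \<alpha> = sets \<mu>" "sets \<alpha>' = sets \<mu>"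
    using assms unfolding lebesgue_split_def by blast+
  then show "sets \<alpha> = sets \<alpha>'" by simp
  fix A assume "A \<in> sets \<alpha>"
  then have A: "A \<in> sets \<mu>" using s by simp
  from lebesgue_split_emeasure[OF assms(1) L] obtain N where N: "N \<in> null_sets L"
    "\<forall>N'\<in>null_sets L. \<forall>A\<in>sets \<mu>. N \<subseteq> N' \<longrightarrow> emeasure \<alpha> A = emeasure \<mu> (A - N')"
    by (rule bexE)
  from lebesgue_split_emeasure[OF assms(2) L] obtain N2 where N2: "N2 \<in> null_sets L"
    "\<forall>N'\<in>null_sets L. \<forall>A\<in>sets \<mu>. N2 \<subseteq> N' \<longrightarrow> emeasure \<alpha>' A = emeasure \<mu> (A - N')"
    by (rule bexE)
  \<comment> \<open>One null set that serves both decompositions, so both values equal that of \<mu>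
    off this set.\<close>
  have u: "N \<union> N2 \<in> null_sets L" using N(1) N2(1) by (rule null_sets.Un)
  show "emeasure \<alpha> A = emeasure \<alpha>' A"
    using N(2)[THEN bspec, OF u, THEN bspec, OF A] N2(2)[THEN bspec, OF u, THEN bspec, OF A]
    by simp
qed

text \<open>\<open>L\<close> has a density \<open>g\<close> with respect to the sum of \<mu> and
  \<open>L\<close>. Its zero set \<open>N\<close> is null for \<open>L\<close> and carries the
  singular part of \<mu>; off \<open>N\<close>, where \<open>g\<close> is positive, null sets of
  \<open>L\<close> are null for the sum and hence for \<mu>.\<close>

lemma lebesgue_split_exists:
  assumes \<mu>: "finite_measure \<mu>" and Lf: "finite_measure L" and L: "sets L = sets \<mu>"
  obtains \<alpha> \<sigma> where "lebesgue_split L \<mu> \<alpha> \<sigma>"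
proof -
  interpret \<mu>: finite_measure \<mu> by fact
  note [simp] = L sets_eq_imp_space_eq[OF L]
  have e: "emeasure (add_measure \<mu> L) A = emeasure \<mu> A + emeasure L A" if "A \<in> sets \<mu>" for A
    using that by (simp add: emeasure_add_measure)
  interpret K: finite_measure "add_measure \<mu> L"
    using Lf \<mu> by (intro finite_measureI)
      (auto simp: e finite_measure.finite_emeasure_space[OF Lf, simplified] \<mu>.finite_emeasure_space)
  have "absolutely_continuous (add_measure \<mu> L) L"
    by (auto simp: absolutely_continuous_def null_sets_def e)
  with Lf obtain g where g[measurable]: "g \<in> borel_measurable (add_measure \<mu> L)"
    and gL: "density (add_measure \<mu> L) g = L"
    using K.Radon_Nikodym_finite_measure[of L] by auto
  have gm: "g \<in> borel_measurable \<mu>" using g by (simp add: measurable_def)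
  define N where "N = {x\<in>space \<mu>. g x = 0}"
  have N[measurable]: "N \<in> sets \<mu>" unfolding N_def using gm by measurable
  have "emeasure L N = (\<integral>\<^sup>+x. g x * indicator N x \<partial>add_measure \<mu> L)"
    by (subst gL[symmetric], intro emeasure_density) auto
  also have "\<dots> = (\<integral>\<^sup>+x. 0 \<partial>add_measure \<mu> L)"
    by (intro nn_integral_cong) (auto simp: N_def indicator_def)
  finally have NL: "N \<in> null_sets L" by auto
  define \<alpha> where "\<alpha> = density \<mu> (indicator (space \<mu> - N))"
  define \<sigma> where "\<sigma> = density \<mu> (indicator N)"
  have e\<alpha>: "emeasure \<alpha> A = emeasure \<mu> (A - N)" if A: "A \<in> sets \<mu>" for A
  proof -
    have "emeasure \<alpha> A = (\<integral>\<^sup>+x. indicator (space \<mu> - N) x * indicator A x \<partial>\<mu>)"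
      unfolding \<alpha>_def using A by (intro emeasure_density) auto
    also have "\<dots> = (\<integral>\<^sup>+x. indicator (A - N) x \<partial>\<mu>)"
      by (intro nn_integral_cong) (auto simp: indicator_def)
    finally show ?thesis using A by simp
  qed
  have e\<sigma>: "emeasure \<sigma> A = emeasure \<mu> (A \<inter> N)" if A: "A \<in> sets \<mu>" for A
  proof -
    have "emeasure \<sigma> A = (\<integral>\<^sup>+x. indicator N x * indicator A x \<partial>\<mu>)"
      unfolding \<sigma>_def using A by (intro emeasure_density) auto
    also have "\<dots> = (\<integral>\<^sup>+x. indicator (A \<inter> N) x \<partial>\<mu>)"
      by (intro nn_integral_cong) (auto simp: indicator_def)
    finally show ?thesis using A by simp
  qed
  have "absolutely_continuous L \<alpha>"
    unfolding absolutely_continuous_def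
  proof
    fix A assume A: "A \<in> null_sets L"
    then have [simp]: "A \<in> sets \<mu>" by auto
    have "(\<integral>\<^sup>+x. g x * indicator A x \<partial>add_measure \<mu> L) = emeasure L A"
      by (subst gL[symmetric], intro emeasure_density[symmetric]) auto
    then have "(\<integral>\<^sup>+x. g x * indicator A x \<partial>add_measure \<mu> L) = 0"
      using null_setsD1[OF A] by simp
    moreover have [measurable]: "A \<in> sets (add_measure \<mu> L)" by simp
    have "(\<lambda>x. g x * indicator A x) \<in> borel_measurable (add_measure \<mu> L)" by measurable
    ultimately have "AE x in add_measure \<mu> L. g x * indicator A x = 0"
      by (simp add: nn_integral_0_iff_AE)
    \<comment> \<open>Off \<open>N\<close> the density \<open>g\<close> is nonzero, so the product
      can vanish there only outside \<open>A\<close>.\<close>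
    then have "AE x in add_measure \<mu> L. x \<notin> A - N"
      by (rule AE_mp) (auto intro!: AE_I2 simp: N_def indicator_def split: if_splits)
    then have "A - N \<in> null_sets (add_measure \<mu> L)"
      by (subst AE_iff_null_sets) auto
    then have "emeasure (add_measure \<mu> L) (A - N) = 0" by (rule null_setsD1)
    then have "emeasure \<alpha> A = 0" using e[of "A - N"] e\<alpha>[of A] N by (simp add: sets.Diff)
    then show "A \<in> null_sets \<alpha>" by (intro null_setsI) (simp_all add: \<alpha>_def)
  qed
  moreover have "mutually_singular L \<sigma>"
  proof -
    have "(space \<mu> - N) \<inter> N = {}" by auto
    then have "emeasure \<sigma> (space \<sigma> - N) = 0" using e\<sigma>[of "space \<mu> - N"] by (simp add: \<sigma>_def)
    then show ?thesis using NL by (auto simp: mutually_singular_def)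
  qed
  moreover have "\<mu> = add_measure \<alpha> \<sigma>"
  proof (rule measure_eqI)
    fix A assume A: "A \<in> sets \<mu>"
    have "(A - N) \<inter> (A \<inter> N) = {}" by auto
    then have "emeasure \<mu> A = emeasure \<mu> (A - N) + emeasure \<mu> (A \<inter> N)"
      using A plus_emeasure[of "A - N" \<mu> "A \<inter> N"] by (simp add: Un_Diff_Int Int_commute)
    moreover have "emeasure (add_measure \<alpha> \<sigma>) A = emeasure \<alpha> A + emeasure \<sigma> A"
      using A by (intro emeasure_add_measure) (auto simp: \<alpha>_def \<sigma>_def)
    ultimately show "emeasure \<mu> A = emeasure (add_measure \<alpha> \<sigma>) A"
      using A by (simp add: e\<alpha> e\<sigma>)
  qed (simp add: \<alpha>_def)
  moreover have "sets \<alpha> = sets \<mu>" "sets \<sigma> = sets \<mu>"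
    by (simp_all add: \<alpha>_def \<sigma>_def)
  ultimately have "lebesgue_split L \<mu> \<alpha> \<sigma>"
    unfolding lebesgue_split_def by blast
  then show ?thesis by (rule that)
qed

lemma ac_part_eqI:
  assumes "lebesgue_split (lebesgue_cball R) \<mu> \<alpha> \<sigma>" "sets (lebesgue_cball R) = sets \<mu>"
  shows "ac_part R \<mu> = \<alpha>"
  unfolding ac_part_def
proof (rule the_equality)
  show "sets \<alpha> = sets \<mu> \<and> absolutely_continuous (lebesgue_cball R) \<alpha> \<and>
    (\<exists>\<sigma>. sets \<sigma> = sets \<mu> \<and> mutually_singular (lebesgue_cball R) \<sigma> \<and> \<mu> = add_measure \<alpha> \<sigma>)"
    using assms(1) unfolding lebesgue_split_def by blast
next
  fix \<beta> assume "sets \<beta> = sets \<mu> \<and> absolutely_continuous (lebesgue_cball R) \<beta> \<and>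
    (\<exists>\<sigma>. sets \<sigma> = sets \<mu> \<and> mutually_singular (lebesgue_cball R) \<sigma> \<and> \<mu> = add_measure \<beta> \<sigma>)"
  then obtain \<tau> where "lebesgue_split (lebesgue_cball R) \<mu> \<beta> \<tau>"
    unfolding lebesgue_split_def by blast
  then show "\<beta> = \<alpha>"
    using lebesgue_split_unique assms by blast
qed

subsection \<open>The pointwise free energy\<close>

text \<open>Real-valued counterpart of \<open>rho\<close>, with \<open>w\<close> in place of
  \<open>V x + h\<close>. At \<open>w = 0\<close> it takes the value 0 instead of infinity, so the
  two agree only where \<open>V x + h\<close> is nonzero.\<close>

definition equilibrium :: "real \<Rightarrow> real \<Rightarrow> real" where
  "equilibrium m w = ((1 - m) / m * w) powr (- (1 / (1 - m)))"

definition free_energy :: "real \<Rightarrow> real \<Rightarrow> real \<Rightarrow> real" where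
  "free_energy m w s = - (1 / (1 - m)) * s powr m + w * s"

lemma equilibrium_pos: "0 < m \<Longrightarrow> m < 1 \<Longrightarrow> 0 < w \<Longrightarrow> 0 < equilibrium m w"
  by (simp add: equilibrium_def)

lemma equilibrium_nonneg: "0 \<le> equilibrium m w"
  by (simp add: equilibrium_def)

lemma equilibrium_mult:
  assumes "0 < m" "m < 1" "0 < w" "0 < l"
  shows "equilibrium m (l * w) = l powr (- (1 / (1 - m))) * equilibrium m w"
  using assms by (simp add: equilibrium_def powr_mult[symmetric] mult_ac)

lemma equilibrium_powr:
  assumes "0 < m" "m < 1" "0 < w"
  shows "equilibrium m w powr (m - 1) = (1 - m) / m * w"
proof -
  have "- (1 / (1 - m)) * (m - 1) = 1" using assms by (simp add: field_simps)
  then show ?thesis using assms by (simp add: equilibrium_def powr_powr)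
qed

text \<open>By concavity \<open>s powr m\<close> lies below its tangent line at the equilibrium
  \<open>r\<close>. The tangent inequality is Young's inequality with weights \<open>m\<close> and
  \<open>1 - m\<close>, and the slope of the tangent is \<open>(1 - m) * w\<close>.\<close>

lemma free_energy_min:
  assumes "0 < m" "m < 1" "0 < w" "0 \<le> s"
  shows "free_energy m w (equilibrium m w) \<le> free_energy m w s"
proof -
  define r where "r = equilibrium m w"
  have r: "0 < r" using assms by (simp add: r_def equilibrium_pos)
  \<comment> \<open>The equilibrium relation solved for \<open>w\<close>, so that only
    \<open>r\<close> and \<open>s\<close> remain.\<close>
  have w: "w = m / (1 - m) * r powr (m - 1)"
    using equilibrium_powr[OF assms(1-3)] assms by (simp add: r_def field_simps)
  have *: "r powr (m - 1) * r = r powr m"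
    using r by (simp add: powr_diff)
  have "s powr m \<le> m * (r powr (m - 1) * s) + (1 - m) * r powr m"
  proof (cases "s = 0")
    case False
    then have s: "0 < s" using assms by simp
    have "s powr m * r powr (1 - m) \<le> m * s + (1 - m) * r"
      using Youngs_inequality_0[of m "1 - m" s r] assms r s by simp
    then have "(s powr m * r powr (1 - m)) * r powr (m - 1) \<le> (m * s + (1 - m) * r) * r powr (m - 1)"
      by (intro mult_right_mono) auto
    also have "(s powr m * r powr (1 - m)) * r powr (m - 1) = s powr m"
      using r by (simp add: mult.assoc powr_add[symmetric])
    also have "(m * s + (1 - m) * r) * r powr (m - 1) = m * (r powr (m - 1) * s) + (1 - m) * r powr m"
      using * by (simp add: algebra_simps)
    finally show ?thesis .
  qed (use assms in auto)
  then have "s powr m / (1 - m) \<le> (m * (r powr (m - 1) * s) + (1 - m) * r powr m) / (1 - m)"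
    using assms by (intro divide_right_mono) auto
  also have "\<dots> = w * s + r powr m"
    using assms by (simp add: w add_divide_distrib)
  finally have 1: "s powr m / (1 - m) \<le> w * s + r powr m" .
  have "w * r = m / (1 - m) * r powr m"
    using * by (simp add: w mult.assoc)
  moreover have "r powr m / (1 - m) = m / (1 - m) * r powr m + r powr m"
    using assms by (simp add: field_simps)
  ultimately show ?thesis
    using 1 by (simp add: free_energy_def r_def[symmetric])
qed

text \<open>Compare the minimum at slope \<open>w\<close> with the one at slope \<open>l * w\<close>: the
  free energy is affine in the slope, so no convexity estimate beyond minimality is needed.\<close>

lemma free_energy_gap:
  assumes "0 < m" "m < 1" "0 < w" "0 < l" "0 \<le> s"
  shows "(1 - l) * w * (s - equilibrium m (l * w))
    \<le> free_energy m w s - free_energy m w (equilibrium m w)"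
proof -
  let ?r = "equilibrium m (l * w)"
  have "free_energy m (l * w) ?r \<le> free_energy m (l * w) s"
    using assms by (intro free_energy_min) auto
  moreover have "free_energy m w (equilibrium m w) \<le> free_energy m w ?r"
    using assms by (intro free_energy_min equilibrium_nonneg) auto
  ultimately show ?thesis
    by (simp add: free_energy_def algebra_simps)
qed

text \<open>\<open>free_energy_gap\<close> at a slope below \<open>w\<close> bounds \<open>s\<close>
  from above, and at a slope above \<open>w\<close> from below. Since rescaling the slope rescales
  the equilibrium by a fixed factor, \<open>K\<close> depends on \<open>m\<close> and
  \<open>e\<close> only.\<close>

lemma deviation_bound:
  assumes m: "0 < m" "m < 1" and e: "0 < e" "e < 1"
  obtains K where "0 < K"
    "\<And>w s. 0 < w \<Longrightarrow> 0 \<le> s \<Longrightarrow> \<bar>s - equilibrium m w\<bar>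
      \<le> e * equilibrium m w + K / w * (free_energy m w s - free_energy m w (equilibrium m w))"
proof -
  \<comment> \<open>Chosen so that the equilibria at the slopes \<open>l1 * w\<close> and
    \<open>l2 * w\<close> are \<open>1 + e\<close> and \<open>1 - e\<close> times the equilibrium at
    \<open>w\<close>.\<close>
  define l1 l2 where "l1 = (1 + e) powr (m - 1)" and "l2 = (1 - e) powr (m - 1)"
  have l: "0 < l1" "l1 < 1" "1 < l2"
  proof -
    show "l1 < 1" using powr_less_mono2_neg[of "m - 1" 1 "1 + e"] m e by (simp add: l1_def)
    show "1 < l2" using powr_less_mono2_neg[of "m - 1" "1 - e" 1] m e by (simp add: l2_def)
  qed (use e in \<open>auto simp: l1_def\<close>)
  have inv: "(m - 1) * - (1 / (1 - m)) = 1" using m by (simp add: field_simps)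
  have p: "l1 powr (- (1 / (1 - m))) = 1 + e" "l2 powr (- (1 / (1 - m))) = 1 - e"
    unfolding l1_def l2_def powr_powr inv using e by auto
  define K where "K = max (1 / (1 - l1)) (1 / (l2 - 1))"
  have K: "1 / (1 - l1) \<le> K" "1 / (l2 - 1) \<le> K" "0 < K"
    using l by (auto simp: K_def less_max_iff_disj)
  show ?thesis
  proof (rule that[OF \<open>0 < K\<close>])
    fix w s :: real assume w: "0 < w" and s: "0 \<le> s"
    define r where "r = equilibrium m w"
    define D where "D = free_energy m w s - free_energy m w r"
    have D: "0 \<le> D" unfolding D_def r_def using free_energy_min[OF m w s] by simp
    have "(1 - l1) * w * (s - (1 + e) * r) \<le> D"
      using free_energy_gap[OF m w l(1) s] equilibrium_mult[OF m w l(1)] by (simp add: D_def r_def p)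
    then have "s - (1 + e) * r \<le> 1 / (1 - l1) * (D / w)"
      using l w by (simp add: field_simps)
    also have "\<dots> \<le> K * (D / w)" using K D w by (intro mult_right_mono) auto
    finally have 1: "s - r \<le> e * r + K / w * D" by (simp add: algebra_simps)
    have "(1 - l2) * w * (s - (1 - e) * r) \<le> D"
      using free_energy_gap[OF m w _ s, of l2] equilibrium_mult[OF m w, of l2] l by (simp add: D_def r_def p)
    then have "(1 - e) * r - s \<le> 1 / (l2 - 1) * (D / w)"
      using l w by (simp add: field_simps)
    also have "\<dots> \<le> K * (D / w)" using K D w by (intro mult_right_mono) auto
    finally have 2: "r - s \<le> e * r + K / w * D" by (simp add: algebra_simps)
    show "\<bar>s - equilibrium m w\<bar>
      \<le> e * equilibrium m w + K / w * (free_energy m w s - free_energy m w (equilibrium m w))"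
      using 1 2 by (simp add: D_def r_def abs_le_iff)
  qed
qed

subsection \<open>Integration over the ball\<close>

text \<open>Makes the integration rules for \<open>density\<close> available for a weighted Dirac
  mass.\<close>

lemma scale_measure_eq_density: "scale_measure c M = density M (\<lambda>_. c)"
  by (rule measure_eqI) (simp_all add: emeasure_density_const)

lemma add_measure_commute:
  assumes "sets \<nu> = sets \<mu>"
  shows "add_measure \<mu> \<nu> = add_measure \<nu> \<mu>"
  by (rule measure_eqI) (use assms in \<open>simp_all add: emeasure_add_measure add.commute\<close>)

section \<open>Lebesgue measure on the open and on the closed ball\<close>

lemma sets_lebesgue_cball: "sets (lebesgue_cball R) = sets (restrict_space borel (cball 0 R))"
  unfolding lebesgue_cball_def by (intro sets_restrict_space_cong) simp

lemma space_lebesgue_cball [simp]: "space (lebesgue_cball R) = cball 0 R"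
  by (simp add: lebesgue_cball_def space_restrict_space)

lemma finite_measure_restrict_lborel:
  assumes "bounded S" "S \<in> sets borel"
  shows "finite_measure (restrict_space lborel S)"
  using emeasure_bounded_finite[OF assms(1)] assms(2)
  by (intro finite_measureI) (simp add: emeasure_restrict_space space_restrict_space)

lemma finite_measure_lebesgue_cball: "finite_measure (lebesgue_cball R)"
  unfolding lebesgue_cball_def by (intro finite_measure_restrict_lborel) auto

text \<open>Energies are integrals over the open ball, whereas the competing measures live on the
  closed one. The lemmas that follow pass between the two through the indicator of the open
  ball.\<close>

abbreviation lebesgue_ball :: "real \<Rightarrow> 'a::euclidean_space measure" where
  "lebesgue_ball R \<equiv> restrict_space lborel (ball 0 R)"

lemma finite_measure_lebesgue_ball: "finite_measure (lebesgue_ball R)"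
  by (intro finite_measure_restrict_lborel) auto

lemma ball_in_sets_lebesgue_cball: "ball 0 R \<in> sets (lebesgue_cball R)"
  by (auto simp: sets_lebesgue_cball sets_restrict_space_iff)

lemma lebesgue_ball_eq: "restrict_space (lebesgue_cball R) (ball 0 R) = lebesgue_ball R"
  unfolding lebesgue_cball_def
  by (subst restrict_restrict_space) (auto intro!: arg_cong[where f="restrict_space lborel"])

lemma set_integral_ball: "(LINT x:ball 0 R|lborel. f x) = integral\<^sup>L (lebesgue_ball R) f"
  for f :: "'a::euclidean_space \<Rightarrow> real"
  by (simp add: set_lebesgue_integral_def integral_restrict_space)

lemma F_fun_eq: "F_fun m V R s =
    - (1 / (1 - m)) * (LINT x|lebesgue_ball R. s x powr m) + (LINT x|lebesgue_ball R. V x * s x)"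
  for V :: "'a::euclidean_space \<Rightarrow> real"
proof -
  have "1 / (m - 1) = - (1 / (1 - m))" by (simp add: minus_divide_right)
  then show ?thesis unfolding F_fun_def set_integral_ball by simp
qed

lemma set_integrable_ball: "set_integrable lborel (ball 0 R) f \<longleftrightarrow> integrable (lebesgue_ball R) f"
  for f :: "'a::euclidean_space \<Rightarrow> real"
  by (simp add: set_integrable_def integrable_restrict_space)

lemma AE_ball: "(AE x in lebesgue_ball R. P x) \<longleftrightarrow> (AE x\<in>ball 0 R in lborel. P x)"
  by (simp add: AE_restrict_space_iff)

lemma
  fixes f :: "'a::euclidean_space \<Rightarrow> real"
  shows integral_cball_indicator:
      "(LINT x|lebesgue_cball R. indicator (ball 0 R) x * f x) = integral\<^sup>L (lebesgue_ball R) f"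
    and integrable_cball_indicator:
      "integrable (lebesgue_cball R) (\<lambda>x. indicator (ball 0 R) x * f x) \<longleftrightarrow> integrable (lebesgue_ball R) f"
    and measurable_cball_indicator:
      "(\<lambda>x. indicator (ball 0 R) x * f x) \<in> borel_measurable (lebesgue_cball R)
        \<longleftrightarrow> f \<in> borel_measurable (lebesgue_ball R)"
  using ball_in_sets_lebesgue_cball[of R, where 'a='a]
    integral_restrict_space[of "ball 0 R" "lebesgue_cball R" f]
    integrable_restrict_space[of "ball 0 R" "lebesgue_cball R" f]
    borel_measurable_restrict_space_iff[of "ball 0 R" "lebesgue_cball R" f]
  by (simp_all add: lebesgue_ball_eq Int_absorb2 ball_subset_cball)

lemma nn_integral_cball_indicator:
  fixes f :: "'a::euclidean_space \<Rightarrow> ennreal"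
  shows "(\<integral>\<^sup>+x. indicator (ball 0 R) x * f x \<partial>lebesgue_cball R) = integral\<^sup>N (lebesgue_ball R) f"
    and measurable_cball_indicator_ennreal:
      "(\<lambda>x. indicator (ball 0 R) x * f x) \<in> borel_measurable (lebesgue_cball R)
        \<longleftrightarrow> f \<in> borel_measurable (lebesgue_ball R)"
  using ball_in_sets_lebesgue_cball[of R, where 'a='a]
    nn_integral_restrict_space[of "ball 0 R" "lebesgue_cball R" f]
    borel_measurable_restrict_space_iff_ennreal[of "ball 0 R" "lebesgue_cball R" f]
  by (simp_all add: lebesgue_ball_eq Int_absorb2 ball_subset_cball mult.commute)

lemma AE_ball_iff_cball:
  fixes P :: "'a::euclidean_space \<Rightarrow> bool"
  shows "(AE x in lebesgue_ball R. P x) \<longleftrightarrow> (AE x in lebesgue_cball R. x \<in> ball 0 R \<longrightarrow> P x)"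
  using AE_restrict_space_iff[of "ball 0 R" "lebesgue_cball R" P]
    ball_in_sets_lebesgue_cball[of R, where 'a='a]
  unfolding lebesgue_ball_eq by (simp add: Int_absorb2 ball_subset_cball del: mem_ball)

lemma AE_cball_imp_ball: "AE x in lebesgue_cball R. P x \<Longrightarrow> AE x in lebesgue_ball R. P x"
  unfolding AE_ball_iff_cball by (auto elim: AE_mp)

lemma
  assumes "continuous_on (cball 0 R) f"
  shows continuous_measurable_cball: "f \<in> borel_measurable (lebesgue_cball R)"
    and continuous_measurable_ball: "f \<in> borel_measurable (lebesgue_ball R)"
proof -
  have *: "f \<in> borel_measurable (restrict_space lborel S)" if "S \<subseteq> cball 0 R" for S
    using borel_measurable_continuous_on_restrict[OF continuous_on_subset[OF assms that]]
      measurable_cong_sets[OF sets_restrict_space_cong[OF sets_lborel, of S] refl] by blast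
  show "f \<in> borel_measurable (lebesgue_cball R)" "f \<in> borel_measurable (lebesgue_ball R)"
    unfolding lebesgue_cball_def by (intro *; auto)+
qed

lemma continuous_cball_bounded:
  fixes f :: "'a::euclidean_space \<Rightarrow> real"
  assumes "continuous_on (cball 0 R) f"
  obtains F where "0 < F" "\<And>x. x \<in> cball 0 R \<Longrightarrow> \<bar>f x\<bar> \<le> F"
proof -
  have "bounded (f ` cball 0 R)"
    using assms by (intro compact_imp_bounded compact_continuous_image) auto
  then show ?thesis
    using that unfolding bounded_pos by auto
qed

lemma integrable_bounded_mult:
  fixes f g :: "'a \<Rightarrow> real"
  assumes "integrable M f" "g \<in> borel_measurable M" "\<And>x. x \<in> space M \<Longrightarrow> \<bar>g x\<bar> \<le> C"
  shows "integrable M (\<lambda>x. g x * f x)"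
proof (rule Bochner_Integration.integrable_bound)
  show "integrable M (\<lambda>x. C * f x)" using assms(1) by simp
  show "AE x in M. norm (g x * f x) \<le> norm (C * f x)"
    using assms(3) by (intro AE_I2) (force simp: abs_mult intro: mult_right_mono order_trans)
qed (use assms in auto)

text \<open>For \<open>0 < m < 1\<close> and nonnegative \<open>s\<close>, \<open>s powr m\<close>
  is at most \<open>1 + s\<close>, which is integrable on a finite measure space.\<close>

lemma integrable_powr:
  fixes f :: "'a \<Rightarrow> real"
  assumes "finite_measure M" "integrable M f" "AE x in M. 0 \<le> f x" "0 < m" "m < 1"
  shows "integrable M (\<lambda>x. f x powr m)"
proof (rule Bochner_Integration.integrable_bound)
  interpret finite_measure M by fact
  show "integrable M (\<lambda>x. 1 + f x)" using assms by simp
  have "s powr m \<le> 1 + s" if "0 \<le> s" for s :: real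
  proof (cases "s \<le> 1")
    case True
    then show ?thesis using powr_mono2[of m s 1] that assms by simp
  next
    case False
    then show ?thesis using powr_mono[of m 1 s] assms by simp
  qed
  then show "AE x in M. norm (f x powr m) \<le> norm (1 + f x)"
    using assms(3) by (auto elim!: AE_mp)
qed (use assms in auto)

section \<open>Measures given by a density on the ball\<close>

lemma density_measure_ennreal:
  fixes f :: "'a::euclidean_space \<Rightarrow> real"
  shows "density_measure R (\<lambda>x. ennreal (f x))
    = density (lebesgue_cball R) (\<lambda>x. ennreal (indicator (ball 0 R) x * f x))"
  unfolding density_measure_def
  by (intro arg_cong[where f="density (lebesgue_cball R)"]) (auto simp: indicator_def)

lemma
  fixes f g :: "'a::euclidean_space \<Rightarrow> real"
  assumes f: "f \<in> borel_measurable (lebesgue_ball R)" "AE x in lebesgue_ball R. 0 \<le> f x"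
    and g: "g \<in> borel_measurable (lebesgue_cball R)"
  shows integral_density_measure: "integral\<^sup>L (density_measure R (\<lambda>x. ennreal (f x))) g
      = (LINT x|lebesgue_ball R. f x * g x)"
    and integrable_density_measure: "integrable (density_measure R (\<lambda>x. ennreal (f x))) g
      \<longleftrightarrow> integrable (lebesgue_ball R) (\<lambda>x. f x * g x)"
proof -
  have nn: "AE x in lebesgue_cball R. 0 \<le> indicator (ball 0 R) x * f x"
    using f(2) unfolding AE_ball_iff_cball by eventually_elim (auto simp: indicator_def)
  have me: "(\<lambda>x. indicator (ball 0 R) x * f x) \<in> borel_measurable (lebesgue_cball R)"
    using f(1) by (simp add: measurable_cball_indicator)
  show "integral\<^sup>L (density_measure R (\<lambda>x. ennreal (f x))) g = (LINT x|lebesgue_ball R. f x * g x)"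
    unfolding density_measure_ennreal
    using integral_cball_indicator[of R "\<lambda>x. f x * g x"]
    by (subst integral_density[OF g me nn]) (simp add: mult.assoc)
  show "integrable (density_measure R (\<lambda>x. ennreal (f x))) g
      \<longleftrightarrow> integrable (lebesgue_ball R) (\<lambda>x. f x * g x)"
    unfolding density_measure_ennreal
    using integrable_cball_indicator[of R "\<lambda>x. f x * g x"]
    by (subst integrable_density[OF g me nn]) (simp add: mult.assoc)
qed

lemma sets_density_measure [simp]: "sets (density_measure R f) = sets (lebesgue_cball R)"
  by (simp add: density_measure_def)

lemma space_density_measure [simp]: "space (density_measure R f) = cball 0 R"
  by (simp add: density_measure_def)

lemma emeasure_density_measure_space:
  assumes "f \<in> borel_measurable (lebesgue_ball R)"
  shows "emeasure (density_measure R f) (space (density_measure R f)) = integral\<^sup>N (lebesgue_ball R) f"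
proof -
  have "emeasure (density_measure R f) (cball 0 R)
      = (\<integral>\<^sup>+x. indicator (ball 0 R) x * f x * indicator (space (lebesgue_cball R)) x \<partial>lebesgue_cball R)"
    unfolding density_measure_def
    using assms sets.top[of "lebesgue_cball R"]
    by (subst emeasure_density) (simp_all add: measurable_cball_indicator_ennreal)
  also have "\<dots> = (\<integral>\<^sup>+x. indicator (ball 0 R) x * f x \<partial>lebesgue_cball R)"
    by (intro nn_integral_cong) simp
  finally show ?thesis by (simp add: nn_integral_cball_indicator)
qed

text \<open>The mass condition stays in \<open>ennreal\<close>, which identifies all negative reals
  with 0. \<open>mass_densitiesD\<close> returns to the reals once \<open>mass\<close> is
  positive.\<close>

lemma mass_densities_iff:
  "\<rho> \<in> mass_densities R mass \<longleftrightarrow> integrable (lebesgue_ball R) \<rho> \<and>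
     (AE x in lebesgue_ball R. 0 \<le> \<rho> x) \<and> ennreal (integral\<^sup>L (lebesgue_ball R) \<rho>) = ennreal mass"
proof -
  have "density_measure R (\<lambda>x. ennreal (\<rho> x)) \<in> mass_measures R mass
    \<longleftrightarrow> ennreal (integral\<^sup>L (lebesgue_ball R) \<rho>) = ennreal mass"
    if "integrable (lebesgue_ball R) \<rho>" "AE x in lebesgue_ball R. 0 \<le> \<rho> x"
  proof -
    have "(\<lambda>x. ennreal (\<rho> x)) \<in> borel_measurable (lebesgue_ball R)"
      using that(1) by measurable
    from emeasure_density_measure_space[OF this] show ?thesis
      using nn_integral_eq_integral[OF that] by (simp add: mass_measures_def sets_lebesgue_cball)
  qed
  then show ?thesis
    unfolding mass_densities_def set_integrable_ball AE_ball by blast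
qed

section \<open>The absolutely continuous part of a measure on the closed ball\<close>

lemma measurable_ac_density: "ac_density R \<mu> \<in> borel_measurable (lebesgue_ball R)"
proof -
  have "ac_density R \<mu> \<in> borel_measurable (lebesgue_cball R)"
    unfolding ac_density_def[abs_def] by measurable
  then show ?thesis
    unfolding lebesgue_ball_eq[symmetric] by (rule measurable_restrict_space1)
qed

lemma nn_integral_ball_le_cball: "integral\<^sup>N (lebesgue_ball R) f \<le> integral\<^sup>N (lebesgue_cball R) f"
  unfolding nn_integral_cball_indicator[symmetric]
  by (intro nn_integral_mono) (auto simp: indicator_def)

text \<open>By the Radon-Nikodym theorem the density integrates \<open>g\<close> as \<alpha> does,
  and \<alpha> is dominated by \<mu>. The singular part is discarded, hence an inequality.\<close>

lemma nn_integral_ac_density_le: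
  fixes \<mu> :: "'a::euclidean_space measure" and g :: "'a \<Rightarrow> real"
  assumes \<mu>: "finite_measure \<mu>" "sets \<mu> = sets (lebesgue_cball R)"
    and g: "g \<in> borel_measurable \<mu>" "\<And>x. x \<in> cball 0 R \<Longrightarrow> 0 \<le> g x"
  shows "(\<integral>\<^sup>+x. ennreal (ac_density R \<mu> x * g x) \<partial>lebesgue_ball R) \<le> (\<integral>\<^sup>+x. ennreal (g x) \<partial>\<mu>)"
proof -
  interpret L: sigma_finite_measure "lebesgue_cball R :: 'a measure"
    using finite_measure_lebesgue_cball by (rule finite_measure.axioms)
  have L: "sets (lebesgue_cball R) = sets \<mu>" using \<mu>(2) by simp
  obtain \<alpha> \<sigma> where sp: "lebesgue_split (lebesgue_cball R) \<mu> \<alpha> \<sigma>"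
    using lebesgue_split_exists[OF \<mu>(1) finite_measure_lebesgue_cball L] by blast
  then have \<alpha>: "sets \<alpha> = sets \<mu>" "absolutely_continuous (lebesgue_cball R) \<alpha>"
    and \<sigma>: "sets \<sigma> = sets \<mu>" and eq: "\<mu> = add_measure \<alpha> \<sigma>"
    unfolding lebesgue_split_def by blast+
  have part: "ac_part R \<mu> = \<alpha>" by (rule ac_part_eqI[OF sp L])
  have gL: "g \<in> borel_measurable (lebesgue_cball R)" "g \<in> borel_measurable \<alpha>"
    using g(1) \<alpha>(1) L measurable_cong_sets by blast+
  have "(\<integral>\<^sup>+x. ennreal (ac_density R \<mu> x * g x) \<partial>lebesgue_ball R)
      \<le> (\<integral>\<^sup>+x. ennreal (ac_density R \<mu> x * g x) \<partial>lebesgue_cball R)"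
    by (rule nn_integral_ball_le_cball)
  also have "\<dots> \<le> (\<integral>\<^sup>+x. RN_deriv (lebesgue_cball R) \<alpha> x * ennreal (g x) \<partial>lebesgue_cball R)"
  proof (rule nn_integral_mono)
    fix x :: 'a assume "x \<in> space (lebesgue_cball R)"
    then have "ennreal (ac_density R \<mu> x * g x)
        = ennreal (enn2real (RN_deriv (lebesgue_cball R) \<alpha> x)) * ennreal (g x)"
      using g(2) by (simp add: ac_density_def part ennreal_mult)
    \<comment> \<open>\<open>enn2real\<close> sends infinity to 0, which can only lower the
      integrand.\<close>
    also have "\<dots> \<le> RN_deriv (lebesgue_cball R) \<alpha> x * ennreal (g x)"
      by (intro mult_right_mono) (simp_all add: ennreal_enn2real_if)
    finally show "ennreal (ac_density R \<mu> x * g x) \<le> RN_deriv (lebesgue_cball R) \<alpha> x * ennreal (g x)" .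
  qed
  also have "\<dots> = (\<integral>\<^sup>+x. ennreal (g x) \<partial>\<alpha>)"
    using gL(1) \<alpha> L by (subst L.RN_deriv_nn_integral) simp_all
  also have "\<dots> \<le> (\<integral>\<^sup>+x. ennreal (g x) \<partial>\<alpha>) + (\<integral>\<^sup>+x. ennreal (g x) \<partial>\<sigma>)" by simp
  also have "\<dots> = (\<integral>\<^sup>+x. ennreal (g x) \<partial>add_measure \<alpha> \<sigma>)"
    using gL(2) \<alpha>(1) \<sigma> by (intro nn_integral_add_measure[symmetric]) simp_all
  finally show ?thesis using eq by metis
qed

subsection \<open>Radial potentials and the choice of h\<close>

locale radial_potential =
  fixes m R :: real and V :: "'a::euclidean_space \<Rightarrow> real"
  assumes m: "0 < m" "m < 1" and R: "0 < R"
    and continuous_V: "continuous_on (cball 0 R) V"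
    and radial_V: "radially_increasing R V"
    and V_0: "V 0 = 0"
begin

lemma V_mono:
  assumes "x \<in> ball 0 R" "y \<in> ball 0 R" "norm x \<le> norm y"
  shows "V x \<le> V y"
proof -
  obtain v where "mono_on {0..<R} v" "\<And>x. x \<in> ball 0 R \<Longrightarrow> V x = v (norm x)"
    using radial_V by (auto simp: radially_increasing_def)
  then show ?thesis
    using assms by (auto simp: mono_on_def)
qed

text \<open>On the open ball this is monotonicity from \<open>V 0 = 0\<close>; continuity extends it
  to the sphere.\<close>

lemma V_nonneg:
  assumes "x \<in> cball 0 R"
  shows "0 \<le> V x"
proof -
  have "0 \<le> V y" if "y \<in> ball 0 R" for y
    using V_mono[of 0 y] that R V_0 by simp
  then show ?thesis
    using continuous_ge_on_closure[of "ball 0 R" V x 0] continuous_V assms R by simp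
qed

lemma measurable_V: "V \<in> borel_measurable (lebesgue_ball R)" "V \<in> borel_measurable (lebesgue_cball R)"
  using continuous_V by (rule continuous_measurable_ball, rule continuous_measurable_cball)

section \<open>The mass of the equilibrium density as a function of h\<close>

lemma a_mass_eq: "a_mass m V R h = (\<integral>\<^sup>+x. rho m V h x \<partial>lebesgue_ball R)"
  by (simp add: a_mass_def nn_integral_restrict_space)

lemma rho_eq: "V x + h \<noteq> 0 \<Longrightarrow> rho m V h x = ennreal (equilibrium m (V x + h))"
  by (simp add: rho_def equilibrium_def)

lemma measurable_equilibrium:
  "(\<lambda>x. equilibrium m (V x + h)) \<in> borel_measurable (lebesgue_ball R)"
  unfolding equilibrium_def using measurable_V(1) by measurable

lemma measurable_rho: "rho m V h \<in> borel_measurable (lebesgue_ball R)"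
proof -
  note [measurable] = measurable_V(1)
  show ?thesis
    unfolding rho_def[abs_def] by measurable
qed

lemma AE_ball_nonzero: "AE x in lebesgue_ball R. x \<in> ball 0 R \<and> x \<noteq> (0::'a)"
  unfolding AE_ball using AE_lborel_singleton[of "0::'a"] by eventually_elim simp

text \<open>Otherwise \<open>h = 0\<close> and, by monotonicity, \<open>V\<close> vanishes on the
  whole ball of radius \<open>norm x\<close>. There \<open>rho\<close> is infinite on a set of
  positive measure, against the finiteness of the mass.\<close>

lemma V_add_pos:
  assumes "0 \<le> h" "a_mass m V R h < top" "x \<in> ball 0 R" "x \<noteq> 0"
  shows "0 < V x + h"
proof (rule ccontr)
  assume "\<not> 0 < V x + h"
  with assms V_nonneg[of x] have 0: "V x = 0" "h = 0" by auto
  have inf: "rho m V h y = top" if "y \<in> ball 0 (norm x)" for y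
  proof -
    have "V y \<le> V x" using that assms by (intro V_mono) auto
    moreover have "0 \<le> V y" using that assms by (intro V_nonneg) auto
    ultimately show ?thesis using 0 by (simp add: rho_def)
  qed
  have "emeasure (lborel :: 'a measure) (ball 0 (norm x)) \<noteq> 0"
    using content_ball_pos[of "norm x" "0::'a"] assms by (auto simp: measure_def)
  then have "top = top * emeasure (lborel :: 'a measure) (ball 0 (norm x))"
    by (simp add: ennreal_top_mult)
  also have "\<dots> = (\<integral>\<^sup>+y. top * indicator (ball 0 (norm x)) y \<partial>(lborel :: 'a measure))"
    by (rule nn_integral_cmult_indicator[symmetric]) simp
  also have "\<dots> \<le> a_mass m V R h"
    unfolding a_mass_def
    using assms inf by (intro nn_integral_mono) (auto simp: indicator_def)
  finally show False using assms by (simp add: top_unique)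
qed

lemma equilibrium_strict_antimono:
  assumes "0 < w" "w < w'"
  shows "equilibrium m w' < equilibrium m w"
  unfolding equilibrium_def using assms m
  by (intro powr_less_mono2_neg mult_strict_left_mono) (simp_all add: field_simps)

text \<open>\<open>rho\<close> decreases strictly in \<open>h\<close> at every point of the ball
  except possibly the origin. Finiteness of the integrals turns this into strict inequality, as the
  ball is not a null set.\<close>

lemma a_mass_strict_antimono:
  assumes "0 \<le> h" "h < h'" "a_mass m V R h < top"
  shows "a_mass m V R h' < a_mass m V R h"
proof -
  have less: "rho m V h' x < rho m V h x" if "x \<in> ball 0 R" "x \<noteq> 0" for x
  proof -
    have "0 < V x + h" using V_add_pos assms that by blast
    then show ?thesis
      using equilibrium_strict_antimono[of "V x + h" "V x + h'"] assms(2)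
      by (simp add: rho_eq ennreal_less_iff equilibrium_nonneg)
  qed
  have le: "AE x in lebesgue_ball R. rho m V h' x \<le> rho m V h x"
    using AE_ball_nonzero by eventually_elim (meson less less_imp_le)
  have "\<not> (AE x in lebesgue_ball R. rho m V h x \<le> rho m V h' x)"
  proof
    assume "AE x in lebesgue_ball R. rho m V h x \<le> rho m V h' x"
    then have ae: "AE x in (lebesgue_ball R :: 'a measure). \<not> True"
      using AE_ball_nonzero by eventually_elim (meson less leD)
    have "emeasure (lebesgue_ball R) {x \<in> space (lebesgue_ball R :: 'a measure). True} = 0"
      by (rule emeasure_eq_0_AE[OF ae])
    moreover have "{x \<in> space (lebesgue_ball R). True} = (ball 0 R :: 'a set)"
      by (auto simp: space_restrict_space)
    ultimately have "emeasure (lebesgue_ball R :: 'a measure) (ball 0 R) = 0"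
      by (simp only:)
    then show False
      using content_ball_pos[OF R, of "0::'a"] by (simp add: emeasure_restrict_space measure_def)
  qed
  moreover have "a_mass m V R h' < top"
    using nn_integral_mono_AE[OF le] assms(3) unfolding a_mass_eq by (rule le_less_trans)
  ultimately show ?thesis
    unfolding a_mass_eq using le by (intro nn_integral_less measurable_rho) auto
qed

text \<open>Justifies the definite description of \<open>h\<close> in \<open>mu_inf\<close>.\<close>

lemma a_mass_inj:
  assumes "0 \<le> h" "0 \<le> h'" "a_mass m V R h = a_mass m V R h'" "a_mass m V R h < top"
  shows "h = h'"
  using a_mass_strict_antimono[of h h'] a_mass_strict_antimono[of h' h] assms
  by (cases h h' rule: linorder_cases) auto

text \<open>Adding a positive \<open>h\<close> cuts off the singularity of the density. The
  resulting constant serves as integrable bound for all larger \<open>h'\<close>.\<close>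

lemma equilibrium_ball_le:
  assumes "0 < h" "h \<le> h'" "x \<in> ball 0 R"
  shows "equilibrium m (V x + h') \<le> equilibrium m h"
proof (cases "V x + h' = h")
  case False
  have "0 \<le> V x" using assms(3) by (intro V_nonneg) auto
  with False show ?thesis
    using equilibrium_strict_antimono[of h "V x + h'"] assms by simp
qed simp

text \<open>Real-valued form of \<open>a_mass\<close> for positive \<open>h\<close>, to which the
  intermediate value theorem applies.\<close>

definition mass_of :: "real \<Rightarrow> real" where
  "mass_of h = (LINT x|lebesgue_ball R. equilibrium m (V x + h))"

lemma a_mass_eq_mass_of:
  assumes "0 < h"
  shows "a_mass m V R h = ennreal (mass_of h)"
proof -
  interpret finite_measure "lebesgue_ball R :: 'a measure" by (rule finite_measure_lebesgue_ball)
  have "integrable (lebesgue_ball R) (\<lambda>x. equilibrium m (V x + h))"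
    using equilibrium_ball_le[OF assms order_refl]
    by (intro integrable_const_bound[of _ "equilibrium m h"] AE_I2 measurable_equilibrium)
      (simp_all add: equilibrium_nonneg space_restrict_space)
  moreover have "a_mass m V R h = (\<integral>\<^sup>+x. ennreal (equilibrium m (V x + h)) \<partial>lebesgue_ball R)"
    unfolding a_mass_eq
  proof (intro nn_integral_cong rho_eq)
    fix x assume "x \<in> space (lebesgue_ball R :: 'a measure)"
    then have "0 \<le> V x" by (intro V_nonneg) (simp add: space_restrict_space)
    then show "V x + h \<noteq> 0" using assms by simp
  qed
  ultimately show ?thesis
    by (simp add: mass_of_def nn_integral_eq_integral equilibrium_nonneg)
qed

lemma isCont_equilibrium: "0 < w \<Longrightarrow> isCont (equilibrium m) w"
  unfolding equilibrium_def[abs_def] using m by (intro continuous_intros) auto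

text \<open>Dominated convergence with the constant bound \<open>equilibrium m h0\<close>. This
  bound blows up as \<open>h0\<close> tends to 0, so the half-line has to start at a positive
  point.\<close>

lemma continuous_mass_of:
  assumes "0 < h0"
  shows "continuous_on {h0..} mass_of"
proof (rule continuous_on_sequentiallyI)
  fix u a assume u: "\<forall>n. u n \<in> {h0..}" and a: "a \<in> {h0..}" and lim: "u \<longlonglongrightarrow> a"
  interpret finite_measure "lebesgue_ball R :: 'a measure" by (rule finite_measure_lebesgue_ball)
  show "(\<lambda>n. mass_of (u n)) \<longlonglongrightarrow> mass_of a"
    unfolding mass_of_def
  proof (rule integral_dominated_convergence[where w="\<lambda>_. equilibrium m h0"])
    show "AE x in lebesgue_ball R. (\<lambda>n. equilibrium m (V x + u n)) \<longlonglongrightarrow> equilibrium m (V x + a)"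
    proof (rule AE_I2)
      fix x assume "x \<in> space (lebesgue_ball R :: 'a measure)"
      then have "0 \<le> V x" by (intro V_nonneg) (simp add: space_restrict_space)
      then have "isCont (equilibrium m) (V x + a)"
        using a assms by (intro isCont_equilibrium) auto
      then show "(\<lambda>n. equilibrium m (V x + u n)) \<longlonglongrightarrow> equilibrium m (V x + a)"
        by (rule isCont_tendsto_compose) (intro tendsto_intros lim)
    qed
    show "AE x in lebesgue_ball R. norm (equilibrium m (V x + u n)) \<le> equilibrium m h0" for n
      using equilibrium_ball_le[OF assms, of "u n"] u
      by (intro AE_I2) (simp add: equilibrium_nonneg space_restrict_space)
  qed (auto intro: measurable_equilibrium)
qed

lemma mass_of_tendsto_0: "((\<lambda>n. mass_of (real (Suc n))) \<longlongrightarrow> 0) sequentially"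
proof (rule tendsto_sandwich)
  interpret finite_measure "lebesgue_ball R :: 'a measure" by (rule finite_measure_lebesgue_ball)
  let ?b = "measure (lebesgue_ball R :: 'a measure) (space (lebesgue_ball R))"
  show "\<forall>\<^sub>F n in sequentially. 0 \<le> mass_of (real (Suc n))"
    by (simp add: mass_of_def equilibrium_nonneg)
  show "\<forall>\<^sub>F n in sequentially. mass_of (real (Suc n)) \<le> ?b * equilibrium m (real (Suc n))"
  proof (intro always_eventually allI)
    fix n
    have b: "equilibrium m (V x + real (Suc n)) \<le> equilibrium m (real (Suc n))" if "x \<in> ball 0 R" for x
      using that by (intro equilibrium_ball_le) auto
    have "mass_of (real (Suc n)) \<le> (LINT x|(lebesgue_ball R :: 'a measure). equilibrium m (real (Suc n)))"
      unfolding mass_of_def using b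
      by (intro integral_mono integrable_const_bound[of _ "equilibrium m (real (Suc n))"] AE_I2
          measurable_equilibrium) (simp_all add: equilibrium_nonneg space_restrict_space)
    then show "mass_of (real (Suc n)) \<le> ?b * equilibrium m (real (Suc n))" by simp
  qed
  have "((\<lambda>n. equilibrium m (real (Suc n))) \<longlongrightarrow> 0) sequentially"
    unfolding equilibrium_def using m
    by (intro tendsto_neg_powr filterlim_tendsto_pos_mult_at_top[OF tendsto_const]
        filterlim_compose[OF filterlim_real_sequentially filterlim_Suc]) simp_all
  from tendsto_mult_right_zero[OF this, of ?b]
  show "((\<lambda>n. ?b * equilibrium m (real (Suc n))) \<longlongrightarrow> 0) sequentially" .
qed simp

text \<open>Convergence takes place in \<open>ennreal\<close>, so that points where \<open>V\<close>
  vanishes, and the limit is infinite, are included.\<close>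

lemma rho_tendsto: "(\<lambda>n. rho m V (1 / real (Suc n)) x) \<longlonglongrightarrow> rho m V 0 x" if "x \<in> ball 0 R"
proof (cases "V x = 0")
  case True
  have "filterlim (\<lambda>n. equilibrium m (1 / real (Suc n))) at_top sequentially"
  proof -
    \<comment> \<open>The scaling law turns the value into a positive power of
      \<open>Suc n\<close>.\<close>
    have "equilibrium m (1 / real (Suc n)) = equilibrium m 1 * real (Suc n) powr (1 / (1 - m))" for n
      using equilibrium_mult[OF m, of 1 "1 / real (Suc n)"]
      by (simp add: powr_divide powr_minus_divide del: of_nat_Suc)
    moreover have "filterlim (\<lambda>n. inverse (real (Suc n) powr (- (1 / (1 - m))))) at_top sequentially"
      using m
      by (intro filterlim_inverse_at_top tendsto_neg_powr always_eventually allI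
        filterlim_compose[OF filterlim_real_sequentially filterlim_Suc]) simp_all
    then have "filterlim (\<lambda>n. equilibrium m 1 * real (Suc n) powr (1 / (1 - m))) at_top sequentially"
      using equilibrium_pos[OF m, of 1]
      by (intro filterlim_tendsto_pos_mult_at_top[OF tendsto_const]) (simp_all add: powr_minus)
    ultimately show ?thesis by simp
  qed
  then have "(\<lambda>n. ennreal (equilibrium m (1 / real (Suc n)))) \<longlonglongrightarrow> top"
    by (simp add: ennreal_tendsto_top_eq_at_top)
  then show ?thesis using True by (simp add: rho_def equilibrium_def)
next
  case False
  then have V: "0 < V x" using V_nonneg[of x] that by (simp add: less_le)
  have "(\<lambda>n. equilibrium m (V x + 1 / real (Suc n))) \<longlonglongrightarrow> equilibrium m (V x + 0)"
    using isCont_equilibrium[of "V x + 0"] V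
    by (intro isCont_tendsto_compose[where g="equilibrium m"] tendsto_intros LIMSEQ_Suc lim_1_over_n) auto
  then have "(\<lambda>n. ennreal (equilibrium m (V x + 1 / real (Suc n)))) \<longlonglongrightarrow> ennreal (equilibrium m (V x + 0))"
    by (rule tendsto_ennrealI)
  moreover have "V x + 1 / real (Suc n) \<noteq> 0" for n using V by (smt (verit) divide_nonneg_nonneg of_nat_0_le_iff)
  ultimately show ?thesis using False by (simp add: rho_eq del: add_0_right)
qed

text \<open>If \<open>h = 0\<close> gives too much mass, so does some small positive
  \<open>h0\<close>, while large \<open>h\<close> give too little. Continuity yields an
  \<open>h\<close> in between with exactly the prescribed mass.\<close>

lemma equilibrium_exists:
  assumes "0 < mass"
  obtains h where "0 \<le> h" "a_mass m V R h \<le> ennreal mass" "h = 0 \<or> a_mass m V R h = ennreal mass"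
proof (cases "a_mass m V R 0 \<le> ennreal mass")
  case True
  then show ?thesis using that[of 0] by simp
next
  case False
  have "\<exists>n. ennreal mass < a_mass m V R (1 / real (Suc n))"
  proof (rule ccontr)
    assume "\<not> ?thesis"
    then have *: "a_mass m V R (1 / real (Suc n)) \<le> ennreal mass" for n by (simp add: not_less)
    \<comment> \<open>Fatou's lemma: if the masses at \<open>1 / Suc n\<close> were all at most
      \<open>mass\<close>, so would be the mass at 0. This covers an infinite
      \<open>a_mass m V R 0\<close> as well.\<close>
    have "a_mass m V R 0 = (\<integral>\<^sup>+x. liminf (\<lambda>n. rho m V (1 / real (Suc n)) x) \<partial>lebesgue_ball R)"
      unfolding a_mass_eq
      by (intro nn_integral_cong lim_imp_Liminf[symmetric] rho_tendsto) (simp_all add: space_restrict_space)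
    also have "\<dots> \<le> liminf (\<lambda>n. a_mass m V R (1 / real (Suc n)))"
      unfolding a_mass_eq by (intro nn_integral_liminf measurable_rho)
    also have "\<dots> \<le> liminf (\<lambda>n::nat. ennreal mass)"
      using * by (intro Liminf_mono always_eventually allI)
    also have "\<dots> = ennreal mass" by (simp add: Liminf_const)
    finally show False using False by simp
  qed
  then obtain n where n: "ennreal mass < a_mass m V R (1 / real (Suc n))" by blast
  define h0 where "h0 = 1 / real (Suc n)"
  have h0: "0 < h0" by (simp add: h0_def)
  with n have ge: "mass \<le> mass_of h0"
    unfolding h0_def[symmetric] using assms by (simp add: a_mass_eq_mass_of ennreal_less_iff)
  obtain k where k: "mass_of (real (Suc i)) < mass" if "k \<le> i" for i
    using order_tendstoD(2)[OF mass_of_tendsto_0 assms] by (auto simp: eventually_sequentially)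
  \<comment> \<open>Large enough to exceed \<open>h0\<close> and to lie beyond the index from which
    the mass is below \<open>mass\<close>.\<close>
  define h1 where "h1 = real (Suc (k + nat \<lceil>h0\<rceil>))"
  have h1: "h0 \<le> h1" "mass_of h1 \<le> mass"
    using k[of "k + nat \<lceil>h0\<rceil>"] unfolding h1_def by linarith+
  have "\<exists>h\<ge>h0. h \<le> h1 \<and> mass_of h = mass"
    using h1 ge by (intro IVT2' continuous_on_subset[OF continuous_mass_of[OF h0]]) auto
  then obtain h where "h0 \<le> h" "mass_of h = mass" by blast
  then show ?thesis
    using h0 by (intro that[of h]) (simp_all add: a_mass_eq_mass_of)
qed

end

subsection \<open>The minimal energy and minimising sequences\<close>

text \<open>Covers both cases of \<open>mu_inf\<close> at once: either the mass is attained or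
  \<open>h = 0\<close>, so \<open>h\<close> times the missing mass is always 0.\<close>

locale equilibrium_state = radial_potential +
  fixes mass h :: real
  assumes mass: "0 < mass" and h: "0 \<le> h"
    and a_mass_le: "a_mass m V R h \<le> ennreal mass"
    and h_or: "h = 0 \<or> a_mass m V R h = ennreal mass"
begin

abbreviation r :: "'a \<Rightarrow> real" where "r x \<equiv> equilibrium m (V x + h)"

text \<open>The mass carried by the density \<open>r\<close>; the remainder
  \<open>mass - bulk_mass\<close> is the weight of the Dirac mass.\<close>

definition bulk_mass :: real where "bulk_mass = enn2real (a_mass m V R h)"

lemma a_mass_fin: "a_mass m V R h < top"
  using a_mass_le by (simp add: le_less_trans)

lemma a_mass_bulk: "a_mass m V R h = ennreal bulk_mass"
  using a_mass_fin by (simp add: bulk_mass_def)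

lemma bulk_mass_bounds: "0 \<le> bulk_mass" "bulk_mass \<le> mass" "h * bulk_mass = h * mass"
proof -
  show "0 \<le> bulk_mass" by (simp add: bulk_mass_def)
  show "bulk_mass \<le> mass" using a_mass_le mass by (simp add: a_mass_bulk ennreal_le_iff)
  show "h * bulk_mass = h * mass" using h_or mass \<open>0 \<le> bulk_mass\<close> by (auto simp: a_mass_bulk)
qed

lemma W_pos: "x \<in> ball 0 R \<Longrightarrow> x \<noteq> 0 \<Longrightarrow> 0 < V x + h"
  using V_add_pos[OF h a_mass_fin] .

lemma AE_W_pos: "AE x in lebesgue_ball R. 0 < V x + h"
  using AE_ball_nonzero by eventually_elim (use W_pos in auto)

text \<open>\<open>V\<close> is smallest at the inner radius \<delta>, so its value at one point of
  that sphere will do. If \<open>R \<le> \<delta>\<close>, no point is concerned and the constant is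
  arbitrary.\<close>

lemma W_lower:
  assumes "0 < \<delta>"
  obtains w where "0 < w" "\<And>x. x \<in> ball 0 R \<Longrightarrow> \<delta> \<le> norm x \<Longrightarrow> w \<le> V x + h"
proof (cases "\<delta> < R")
  case True
  obtain y :: 'a where y: "norm y = \<delta>"
    using vector_choose_size assms by (metis less_imp_le)
  with True assms have yb: "y \<in> ball 0 R" "y \<noteq> 0" by auto
  show ?thesis
    using W_pos[OF yb] V_mono[OF yb(1)] y by (intro that[of "V y + h"]) auto
next
  case False
  then show ?thesis by (intro that[of 1]) auto
qed

lemma rho_eq_r: "AE x in lebesgue_ball R. rho m V h x = ennreal (r x)"
  using AE_W_pos by eventually_elim (simp add: rho_eq)

lemma nn_integral_r: "(\<integral>\<^sup>+x. ennreal (r x) \<partial>lebesgue_ball R) = ennreal bulk_mass"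
  using rho_eq_r unfolding a_mass_bulk[symmetric] a_mass_eq
  by (intro nn_integral_cong_AE) (auto elim!: AE_mp)

lemma integrable_r: "integrable (lebesgue_ball R) r"
  by (intro integrableI_nonneg measurable_equilibrium)
    (simp_all add: equilibrium_nonneg nn_integral_r)

lemma integral_r: "integral\<^sup>L (lebesgue_ball R) r = bulk_mass"
  using nn_integral_r bulk_mass_bounds(1) by (intro integral_eq_nn_integral[THEN trans] measurable_equilibrium)
    (simp_all add: equilibrium_nonneg)

lemma integrable_ball_mult:
  fixes f g :: "'a \<Rightarrow> real"
  assumes "continuous_on (cball 0 R) f" "integrable (lebesgue_ball R) g"
  shows "integrable (lebesgue_ball R) (\<lambda>x. f x * g x)"
proof -
  obtain F where "0 < F" "\<And>x. x \<in> cball 0 R \<Longrightarrow> \<bar>f x\<bar> \<le> F"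
    using continuous_cball_bounded[OF assms(1)] by blast
  then show ?thesis
    by (intro integrable_bounded_mult[OF assms(2) continuous_measurable_ball[OF assms(1)], of F])
      (auto simp: space_restrict_space)
qed

lemma
  assumes s: "integrable (lebesgue_ball R) s" "AE x in lebesgue_ball R. 0 \<le> s x"
  shows integrable_free_energy: "integrable (lebesgue_ball R) (\<lambda>x. free_energy m (V x + h) (s x))"
    and integral_free_energy: "(LINT x|lebesgue_ball R. free_energy m (V x + h) (s x))
      = - (1 / (1 - m)) * (LINT x|lebesgue_ball R. s x powr m) + (LINT x|lebesgue_ball R. V x * s x)
        + h * (LINT x|lebesgue_ball R. s x)"
proof -
  note p = integrable_powr[OF finite_measure_lebesgue_ball s m]
  note v = integrable_ball_mult[OF continuous_V s(1)]
  have eq: "free_energy m (V x + h) (s x) = - (1 / (1 - m)) * s x powr m + V x * s x + h * s x" for x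
    by (simp add: free_energy_def algebra_simps)
  show "integrable (lebesgue_ball R) (\<lambda>x. free_energy m (V x + h) (s x))"
    unfolding eq using p v s by (intro Bochner_Integration.integrable_add integrable_mult_right)
  show "(LINT x|lebesgue_ball R. free_energy m (V x + h) (s x))
      = - (1 / (1 - m)) * (LINT x|lebesgue_ball R. s x powr m) + (LINT x|lebesgue_ball R. V x * s x)
        + h * (LINT x|lebesgue_ball R. s x)"
    unfolding eq using p v s
    by (simp add: Bochner_Integration.integral_add del: minus_divide_left)
qed

definition gap :: "('a \<Rightarrow> real) \<Rightarrow> 'a \<Rightarrow> real" where
  "gap s x = free_energy m (V x + h) (s x) - free_energy m (V x + h) (r x)"

lemma r_nonneg: "AE x in lebesgue_ball R. 0 \<le> r x"
  by (simp add: equilibrium_nonneg)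

lemma gap_nonneg:
  assumes "AE x in lebesgue_ball R. 0 \<le> s x"
  shows "AE x in lebesgue_ball R. 0 \<le> gap s x"
  using assms AE_W_pos by eventually_elim (use free_energy_min[OF m] in \<open>simp add: gap_def\<close>)

text \<open>The energy of \<open>r\<close>, although \<open>r\<close> has mass
  \<open>bulk_mass\<close> only and need not be admissible.\<close>

definition min_energy :: real where
  "min_energy = - (1 / (1 - m)) * (LINT x|lebesgue_ball R. r x powr m) + (LINT x|lebesgue_ball R. V x * r x)"

text \<open>The energy of \<open>r\<close> contributes \<open>h * bulk_mass\<close>, which equals
  \<open>h * mass\<close>. The mass of \<open>s\<close> is left free because the identity is also
  applied to the absolutely continuous part of a measure, which may carry less than
  \<open>mass\<close>.\<close>

lemma
  assumes s: "integrable (lebesgue_ball R) s" "AE x in lebesgue_ball R. 0 \<le> s x"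
  shows integrable_gap: "integrable (lebesgue_ball R) (gap s)"
    and integral_gap: "integral\<^sup>L (lebesgue_ball R) (gap s)
      = F_fun m V R s + h * (integral\<^sup>L (lebesgue_ball R) s - mass) - min_energy"
    and integral_gap_nonneg: "0 \<le> integral\<^sup>L (lebesgue_ball R) (gap s)"
proof -
  note i = integrable_free_energy[OF s] integrable_free_energy[OF integrable_r r_nonneg]
  show "integrable (lebesgue_ball R) (gap s)"
    unfolding gap_def[abs_def] using i by (rule Bochner_Integration.integrable_diff)
  have 1: "(LINT x|lebesgue_ball R. free_energy m (V x + h) (s x))
      = F_fun m V R s + h * integral\<^sup>L (lebesgue_ball R) s"
    by (simp only: integral_free_energy[OF s] F_fun_eq)
  have 2: "(LINT x|lebesgue_ball R. free_energy m (V x + h) (r x)) = min_energy + h * mass"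
    by (simp only: integral_free_energy[OF integrable_r r_nonneg] integral_r bulk_mass_bounds(3) min_energy_def)
  show "integral\<^sup>L (lebesgue_ball R) (gap s)
      = F_fun m V R s + h * (integral\<^sup>L (lebesgue_ball R) s - mass) - min_energy"
    unfolding gap_def[abs_def] Bochner_Integration.integral_diff[OF i] 1 2
    by (simp only: algebra_simps)
  show "0 \<le> integral\<^sup>L (lebesgue_ball R) (gap s)"
    using gap_nonneg[OF s(2)] by (rule integral_nonneg_AE)
qed

section \<open>Weak-star convergence of minimising sequences\<close>

lemma mass_densitiesD:
  assumes "s \<in> mass_densities R mass"
  shows "integrable (lebesgue_ball R) s" "AE x in lebesgue_ball R. 0 \<le> s x"
    "integral\<^sup>L (lebesgue_ball R) s = mass"
proof -
  show *: "integrable (lebesgue_ball R) s" "AE x in lebesgue_ball R. 0 \<le> s x"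
    using assms by (simp_all add: mass_densities_iff)
  have "0 \<le> integral\<^sup>L (lebesgue_ball R) s" using *(2) by (rule integral_nonneg_AE)
  then show "integral\<^sup>L (lebesgue_ball R) s = mass"
    using assms mass by (simp add: mass_densities_iff)
qed

text \<open>Estimate the integral of \<open>(f x - f 0) * (s x - r x)\<close>. Within distance
  \<delta> of the origin the first factor is small; farther out \<open>V + h\<close> is at least
  \<open>w\<close> and \<open>deviation_bound\<close> controls the second. The constant
  \<open>C\<close> does not depend on \<open>s\<close>.\<close>

lemma test_integral_bound:
  assumes f: "continuous_on (cball 0 R) f" and \<eta>: "0 < \<eta>"
  obtains C where "0 < C" "\<And>s. s \<in> mass_densities R mass \<Longrightarrow>
    \<bar>(LINT x|lebesgue_ball R. s x * f x) - ((mass - bulk_mass) * f 0 + (LINT x|lebesgue_ball R. r x * f x))\<bar>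
      \<le> \<eta> + C * integral\<^sup>L (lebesgue_ball R) (gap s)"
proof -
  obtain F where F: "0 < F" "\<And>x. x \<in> cball 0 R \<Longrightarrow> \<bar>f x\<bar> \<le> F"
    using continuous_cball_bounded[OF f] by blast
  \<comment> \<open>With these choices the terms weighted by \<open>a\<close> and by
    \<open>e\<close> integrate to at most half of \<eta> each, because both \<open>s\<close> and
    \<open>r\<close> have mass at most \<open>mass\<close>.\<close>
  define a where "a = \<eta> / (4 * mass)"
  define e where "e = min (1/2) (\<eta> / (4 * F * mass))"
  have a: "0 < a" and e: "0 < e" "e < 1" using \<eta> mass F by (simp_all add: a_def e_def)
  have "e \<le> \<eta> / (4 * F * mass)" by (simp add: e_def)
  then have e4: "4 * F * mass * e \<le> \<eta>" using F mass by (simp add: field_simps)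
  have a4: "4 * mass * a = \<eta>" using mass by (simp add: a_def)
  have "0 \<in> cball 0 R" using R by simp
  then obtain \<delta> where \<delta>: "0 < \<delta>"
    "\<And>x. x \<in> cball 0 R \<Longrightarrow> dist x 0 < \<delta> \<Longrightarrow> dist (f x) (f 0) < a"
    using f a unfolding continuous_on_iff by blast
  obtain w where w: "0 < w" "\<And>x. x \<in> ball 0 R \<Longrightarrow> \<delta> \<le> norm x \<Longrightarrow> w \<le> V x + h"
    using W_lower[OF \<delta>(1)] by blast
  obtain K where K: "0 < K"
    "\<And>w s. 0 < w \<Longrightarrow> 0 \<le> s \<Longrightarrow> \<bar>s - equilibrium m w\<bar>
      \<le> e * equilibrium m w + K / w * (free_energy m w s - free_energy m w (equilibrium m w))"
    using deviation_bound[OF m e] by blast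
  define C where "C = 2 * F * K / w"
  show ?thesis
  proof (rule that)
    show "0 < C" using F K w by (simp add: C_def)
    fix s :: "'a \<Rightarrow> real" assume "s \<in> mass_densities R mass"
    note s = mass_densitiesD[OF this]
    have pointwise: "\<bar>(f x - f 0) * (s x - r x)\<bar> \<le> a * (s x + r x) + 2 * F * e * r x + C * gap s x"
      if x: "x \<in> ball 0 R" "x \<noteq> 0" and sx: "0 \<le> s x" for x
    proof -
      have W: "0 < V x + h" using W_pos[OF x] .
      have g: "0 \<le> gap s x" using free_energy_min[OF m W sx] by (simp add: gap_def)
      have r0: "0 \<le> r x" by (rule equilibrium_nonneg)
      have xc: "x \<in> cball 0 R" using x by simp
      have nn: "0 \<le> a * (s x + r x)" "0 \<le> 2 * F * e * r x" "0 \<le> C * gap s x"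
        using a sx r0 F e g \<open>0 < C\<close> by simp_all
      show ?thesis
      proof (cases "norm x < \<delta>")
        case True
        then have "\<bar>f x - f 0\<bar> \<le> a"
          using \<delta>(2)[OF xc] by (simp add: dist_real_def)
        moreover have "\<bar>s x - r x\<bar> \<le> s x + r x" using sx r0 by simp
        ultimately have "\<bar>(f x - f 0) * (s x - r x)\<bar> \<le> a * (s x + r x)"
          unfolding abs_mult using a by (intro mult_mono) auto
        then show ?thesis using nn by linarith
      next
        case False
        have "\<bar>s x - r x\<bar> \<le> e * r x + K / (V x + h) * gap s x"
          using K(2)[OF W sx] by (simp add: gap_def)
        also have "K / (V x + h) * gap s x \<le> K / w * gap s x"
          using w(2)[OF x(1)] False K w(1) g by (intro mult_right_mono divide_left_mono) auto
        finally have 1: "\<bar>s x - r x\<bar> \<le> e * r x + K / w * gap s x" by simp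
        have 2: "\<bar>f x - f 0\<bar> \<le> 2 * F"
          using F(2)[OF xc] F(2)[of 0] R by simp
        have "\<bar>(f x - f 0) * (s x - r x)\<bar> \<le> 2 * F * (e * r x + K / w * gap s x)"
          unfolding abs_mult using 1 2 F by (intro mult_mono) auto
        also have "\<dots> = 2 * F * e * r x + C * gap s x"
          by (simp add: C_def algebra_simps)
        finally show ?thesis using nn by linarith
      qed
    qed
    have AE: "AE x in lebesgue_ball R.
        \<bar>(f x - f 0) * (s x - r x)\<bar> \<le> a * (s x + r x) + 2 * F * e * r x + C * gap s x"
      using s(2) AE_ball_nonzero by eventually_elim (use pointwise in blast)
    note [simp] = s(1) integrable_r integrable_gap[OF s(1,2)]
      integrable_ball_mult[OF f s(1)] integrable_ball_mult[OF f integrable_r]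
    have eq: "(f x - f 0) * (s x - r x) = f x * s x - f x * r x - f 0 * s x + f 0 * r x" for x
      by (simp add: algebra_simps)
    have i: "integrable (lebesgue_ball R) (\<lambda>x. (f x - f 0) * (s x - r x))"
      unfolding eq by simp
    \<comment> \<open>The constant \<open>f 0\<close> integrates against \<open>s - r\<close> to
      \<open>f 0\<close> times the missing mass, which is the Dirac term.\<close>
    have "(LINT x|lebesgue_ball R. (f x - f 0) * (s x - r x))
        = (LINT x|lebesgue_ball R. s x * f x) - ((mass - bulk_mass) * f 0 + (LINT x|lebesgue_ball R. r x * f x))"
    proof -
      have "(LINT x|lebesgue_ball R. (f x - f 0) * (s x - r x))
        = (LINT x|lebesgue_ball R. f x * s x) - (LINT x|lebesgue_ball R. f x * r x) - f 0 * mass + f 0 * bulk_mass"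
        unfolding eq by (simp add: s(3) integral_r)
      then show ?thesis by (simp only: mult.commute[of "f _"]) (simp add: algebra_simps)
    qed
    moreover have "\<bar>LINT x|lebesgue_ball R. (f x - f 0) * (s x - r x)\<bar>
        \<le> (LINT x|lebesgue_ball R. \<bar>(f x - f 0) * (s x - r x)\<bar>)"
      by (rule integral_abs_bound)
    moreover have "\<dots> \<le> (LINT x|lebesgue_ball R. a * (s x + r x) + 2 * F * e * r x + C * gap s x)"
      by (rule integral_mono_AE[OF integrable_abs[OF i] _ AE]) simp
    moreover have "\<dots> = a * (mass + bulk_mass) + 2 * F * e * bulk_mass + C * integral\<^sup>L (lebesgue_ball R) (gap s)"
      by (simp add: s(3) integral_r)
    moreover have "a * (mass + bulk_mass) + 2 * F * e * bulk_mass \<le> \<eta>"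
    proof -
      have "a * (mass + bulk_mass) \<le> a * (2 * mass)" "2 * F * e * bulk_mass \<le> 2 * F * e * mass"
        using a bulk_mass_bounds F e by (intro mult_left_mono; simp)+
      then show ?thesis using e4 a4 by (simp add: algebra_simps)
    qed
    ultimately show "\<bar>(LINT x|lebesgue_ball R. s x * f x)
        - ((mass - bulk_mass) * f 0 + (LINT x|lebesgue_ball R. r x * f x))\<bar>
      \<le> \<eta> + C * integral\<^sup>L (lebesgue_ball R) (gap s)"
      by linarith
  qed
qed

lemma test_integral_tendsto:
  assumes s: "\<And>j. s j \<in> mass_densities R mass"
    and lim: "(\<lambda>j. F_fun m V R (s j)) \<longlonglongrightarrow> min_energy"
    and f: "continuous_on (cball 0 R) f"
  shows "(\<lambda>j::nat. LINT x|lebesgue_ball R. s j x * f x)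
    \<longlonglongrightarrow> (mass - bulk_mass) * f 0 + (LINT x|lebesgue_ball R. r x * f x)"
proof (rule LIMSEQ_I)
  fix \<eta> :: real assume "0 < \<eta>"
  then have \<eta>: "0 < \<eta> / 2" by simp
  obtain C where C: "0 < C" "\<And>s. s \<in> mass_densities R mass \<Longrightarrow>
    \<bar>(LINT x|lebesgue_ball R. s x * f x) - ((mass - bulk_mass) * f 0 + (LINT x|lebesgue_ball R. r x * f x))\<bar>
      \<le> \<eta> / 2 + C * integral\<^sup>L (lebesgue_ball R) (gap s)"
    using test_integral_bound[OF f \<eta>] by blast
  \<comment> \<open>Each \<open>s j\<close> has the prescribed mass, so the term with factor
    \<open>h\<close> in \<open>integral_gap\<close> vanishes and the integrated gap is exactly the
    excess energy.\<close>
  have "integral\<^sup>L (lebesgue_ball R) (gap (s j)) = F_fun m V R (s j) - min_energy" for j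
    using integral_gap[OF mass_densitiesD(1,2)[OF s]] mass_densitiesD(3)[OF s] by simp
  then have gap0: "(\<lambda>j. C * integral\<^sup>L (lebesgue_ball R) (gap (s j))) \<longlonglongrightarrow> 0"
    using tendsto_mult_right_zero[OF LIM_zero[OF lim], of C] by simp
  from LIMSEQ_D[OF gap0 \<eta>] obtain N where
    N: "\<And>j. N \<le> j \<Longrightarrow> C * integral\<^sup>L (lebesgue_ball R) (gap (s j)) < \<eta> / 2"
    by (force simp: abs_less_iff)
  show "\<exists>N. \<forall>j\<ge>N. norm ((LINT x|lebesgue_ball R. s j x * f x)
      - ((mass - bulk_mass) * f 0 + (LINT x|lebesgue_ball R. r x * f x))) < \<eta>"
  proof (intro exI allI impI)
    fix j assume "N \<le> j"
    from N[OF this] C(2)[OF s[of j]] show "norm ((LINT x|lebesgue_ball R. s j x * f x)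
      - ((mass - bulk_mass) * f 0 + (LINT x|lebesgue_ball R. r x * f x))) < \<eta>"
      unfolding real_norm_def by linarith
  qed
qed

section \<open>The limit measure and its relaxed energy\<close>

definition \<mu>0 :: "'a measure" where
  "\<mu>0 = add_measure (scale_measure (ennreal mass - a_mass m V R h) (return (lebesgue_cball R) 0))
     (density_measure R (rho m V h))"

lemma excess_mass: "ennreal mass - a_mass m V R h = ennreal (mass - bulk_mass)"
  using bulk_mass_bounds by (simp add: a_mass_bulk ennreal_minus)

text \<open>The two densities can differ only at the origin, a null set, where \<open>rho\<close>
  may be infinite.\<close>

lemma density_measure_rho: "density_measure R (rho m V h) = density_measure R (\<lambda>x. ennreal (r x))"
proof -
  have "AE x in lebesgue_cball R. x \<in> ball 0 R \<longrightarrow> rho m V h x = ennreal (r x)"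
    using rho_eq_r unfolding AE_ball_iff_cball .
  moreover have "(\<lambda>x. ennreal (r x)) \<in> borel_measurable (lebesgue_ball R)"
    using measurable_equilibrium by measurable
  ultimately show ?thesis
    unfolding density_measure_def
    by (intro density_cong) (auto simp: measurable_cball_indicator_ennreal measurable_rho elim!: AE_mp)
qed

lemma sets_\<mu>0 [simp]: "sets \<mu>0 = sets (lebesgue_cball R)"
  by (simp add: \<mu>0_def)

lemma zero_in_cball: "(0::'a) \<in> space (lebesgue_cball R)"
  using R by simp

lemma
  fixes g :: "'a \<Rightarrow> real"
  assumes "g \<in> borel_measurable (lebesgue_cball R)"
  shows integrable_delta:
      "integrable (scale_measure (ennreal (mass - bulk_mass)) (return (lebesgue_cball R) 0)) g"
    and integral_delta:
      "integral\<^sup>L (scale_measure (ennreal (mass - bulk_mass)) (return (lebesgue_cball R) 0)) g = (mass - bulk_mass) * g 0"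
proof -
  have g: "g \<in> borel_measurable (return (lebesgue_cball R) 0)" using assms by simp
  have "integrable (return (lebesgue_cball R) 0) g"
    using assms zero_in_cball g
    by (intro integrableI_bounded) (simp_all add: nn_integral_return)
  then show "integrable (scale_measure (ennreal (mass - bulk_mass)) (return (lebesgue_cball R) 0)) g"
    unfolding scale_measure_eq_density using bulk_mass_bounds(2) g by (subst integrable_density) simp_all
  show "integral\<^sup>L (scale_measure (ennreal (mass - bulk_mass)) (return (lebesgue_cball R) 0)) g = (mass - bulk_mass) * g 0"
    unfolding scale_measure_eq_density using bulk_mass_bounds(2) g assms zero_in_cball
    by (subst integral_density) (simp_all add: integral_return)
qed

lemma integral_\<mu>0:
  assumes f: "continuous_on (cball 0 R) f"
  shows "integral\<^sup>L \<mu>0 f = (mass - bulk_mass) * f 0 + (LINT x|lebesgue_ball R. r x * f x)"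
proof -
  note fm = continuous_measurable_cball[OF f]
  have "integrable (density_measure R (\<lambda>x. ennreal (r x))) f"
    using integrable_ball_mult[OF f integrable_r]
    by (subst integrable_density_measure[OF measurable_equilibrium r_nonneg fm]) (simp add: mult.commute)
  then show ?thesis
    unfolding \<mu>0_def excess_mass density_measure_rho
    using integrable_delta[OF fm] integral_delta[OF fm]
      integral_density_measure[OF measurable_equilibrium r_nonneg fm]
    by (subst integral_add_measure) simp_all
qed

lemma \<mu>0_mass: "\<mu>0 \<in> mass_measures R mass"
proof -
  have "emeasure \<mu>0 (space \<mu>0) = ennreal (mass - bulk_mass) + ennreal bulk_mass"
  proof -
    have "space \<mu>0 = cball 0 R" using sets_eq_imp_space_eq[OF sets_\<mu>0] by simp
    moreover have "cball 0 R \<in> sets (lebesgue_cball R :: 'a measure)"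
      using sets.top[of "lebesgue_cball R :: 'a measure"] by simp
    moreover have "emeasure (density_measure R (rho m V h)) (cball 0 R) = ennreal bulk_mass"
      using emeasure_density_measure_space[OF measurable_rho] by (simp add: a_mass_eq[symmetric] a_mass_bulk)
    ultimately show ?thesis
      unfolding \<mu>0_def excess_mass using R by (simp add: emeasure_add_measure)
  qed
  also have "\<dots> = ennreal mass" using bulk_mass_bounds by (simp flip: ennreal_plus)
  finally show ?thesis
    by (simp add: mass_measures_def sets_lebesgue_cball)
qed

lemma sigma_finite_cball: "sigma_finite_measure (lebesgue_cball R)"
  using finite_measure_lebesgue_cball by (rule finite_measure.axioms)

text \<open>The Dirac part sits on the null set \<open>{0}\<close> and the other summand has a
  density, so the sum defining \<open>\<mu>0\<close> is already its Lebesgue decomposition.\<close>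

lemma ac_part_\<mu>0: "ac_part R \<mu>0 = density_measure R (rho m V h)"
proof (rule ac_part_eqI)
  let ?d = "scale_measure (ennreal mass - a_mass m V R h) (return (lebesgue_cball R) (0::'a))"
  have meas: "(\<lambda>x. indicator (ball 0 R) x * rho m V h x) \<in> borel_measurable (lebesgue_cball R)"
    by (simp add: measurable_cball_indicator_ennreal measurable_rho)
  have "absolutely_continuous (lebesgue_cball R) (density_measure R (rho m V h))"
    unfolding density_measure_def using meas by (rule absolutely_continuousI_density)
  moreover have "mutually_singular (lebesgue_cball R) ?d"
    unfolding mutually_singular_def
  proof
    have "{0} \<in> sets (lebesgue_cball R :: 'a measure)"
      using R by (simp add: sets_lebesgue_cball sets_restrict_space_iff)
    moreover have "emeasure (lebesgue_cball R) {0::'a} = 0"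
      unfolding lebesgue_cball_def using R by (simp add: emeasure_restrict_space)
    ultimately show n: "{0} \<in> null_sets (lebesgue_cball R :: 'a measure)" by auto
    then have "cball 0 R - {0} \<in> sets (lebesgue_cball R :: 'a measure)"
      using sets.top[of "lebesgue_cball R :: 'a measure"] by auto
    then show "emeasure ?d (space ?d - {0}) = 0"
      by (simp add: space_scale_measure)
  qed
  moreover have "\<mu>0 = add_measure (density_measure R (rho m V h)) ?d"
    unfolding \<mu>0_def by (rule add_measure_commute) simp
  moreover have "sets (density_measure R (rho m V h)) = sets \<mu>0" "sets ?d = sets \<mu>0" by simp_all
  ultimately show "lebesgue_split (lebesgue_cball R) \<mu>0 (density_measure R (rho m V h)) ?d"
    unfolding lebesgue_split_def by blast
qed simp

lemma ac_density_\<mu>0: "AE x in lebesgue_ball R. ac_density R \<mu>0 x = r x"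
proof -
  interpret sigma_finite_measure "lebesgue_cball R :: 'a measure" by (rule sigma_finite_cball)
  have "(\<lambda>x. indicator (ball 0 R) x * rho m V h x) \<in> borel_measurable (lebesgue_cball R)"
    by (simp add: measurable_cball_indicator_ennreal measurable_rho)
  then have "AE x in lebesgue_cball R. indicator (ball 0 R) x * rho m V h x
      = RN_deriv (lebesgue_cball R) (density_measure R (rho m V h)) x"
    by (rule RN_deriv_unique) (simp add: density_measure_def)
  from AE_cball_imp_ball[OF this] rho_eq_r AE_ball_nonzero show ?thesis
    unfolding ac_density_def ac_part_\<mu>0
  proof eventually_elim
    case (elim x)
    then have "RN_deriv (lebesgue_cball R) (density_measure R (rho m V h)) x = ennreal (r x)"
      by (simp add: indicator_def)
    then show ?case by (simp add: equilibrium_nonneg)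
  qed
qed

lemma F_relaxed_\<mu>0: "F_relaxed m V R \<mu>0 = min_energy"
proof -
  have "(LINT x|lebesgue_ball R. ac_density R \<mu>0 x powr m) = (LINT x|lebesgue_ball R. r x powr m)"
  proof (rule integral_cong_AE)
    note [measurable] = measurable_ac_density measurable_equilibrium
    show "(\<lambda>x. ac_density R \<mu>0 x powr m) \<in> borel_measurable (lebesgue_ball R)"
      "(\<lambda>x. r x powr m) \<in> borel_measurable (lebesgue_ball R)" by measurable
    show "AE x in lebesgue_ball R. ac_density R \<mu>0 x powr m = r x powr m"
      using ac_density_\<mu>0 by eventually_elim simp
  qed
  then show ?thesis
    unfolding F_relaxed_def set_integral_ball integral_\<mu>0[OF continuous_V] min_energy_def
    by (simp add: V_0 mult.commute)
qed

section \<open>Lower bounds, near-minimisers and the two infima\<close>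

lemma F_fun_ge: "s \<in> mass_densities R mass \<Longrightarrow> min_energy \<le> F_fun m V R s"
  using integral_gap[of s] integral_gap_nonneg[of s] mass_densitiesD[of s] by simp

text \<open>Integrating \<open>V + h\<close>, which is nonnegative, against \<mu> gives at least its
  integral against the absolutely continuous density. This pays both for the potential energy of the
  singular part and for the mass missing from the density; what remains is the nonnegative
  integrated gap of the density.\<close>

lemma F_relaxed_ge:
  assumes "\<mu> \<in> mass_measures R mass"
  shows "min_energy \<le> F_relaxed m V R \<mu>"
proof -
  let ?f = "ac_density R \<mu>"
  have sets: "sets \<mu> = sets (lebesgue_cball R)" and em: "emeasure \<mu> (space \<mu>) = ennreal mass"
    using assms by (simp_all add: mass_measures_def sets_lebesgue_cball)
  have sp: "space \<mu> = cball 0 R" using sets_eq_imp_space_eq[OF sets] by simp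
  interpret \<mu>: finite_measure \<mu> by (rule finite_measureI) (simp add: em)
  have tot: "measure \<mu> (space \<mu>) = mass" using em mass by (simp add: measure_def)
  have f0: "AE x in lebesgue_ball R. 0 \<le> ?f x" by (simp add: ac_density_def)
  note le = nn_integral_ac_density_le[OF \<mu>.finite_measure_axioms sets]
  \<comment> \<open>The test function 1 shows that the density has finite mass.\<close>
  have "(\<integral>\<^sup>+x. ennreal (?f x * 1) \<partial>lebesgue_ball R) \<le> (\<integral>\<^sup>+x. ennreal 1 \<partial>\<mu>)" by (rule le) simp_all
  then have "(\<integral>\<^sup>+x. ennreal (?f x) \<partial>lebesgue_ball R) < \<infinity>"
    using em by (simp add: le_less_trans)
  then have f: "integrable (lebesgue_ball R) ?f"
    using measurable_ac_density by (intro integrableI_nonneg f0) auto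
  have "V \<in> borel_measurable \<mu>"
    using measurable_V(2) measurable_cong_sets[OF sets refl] by blast
  moreover obtain F where "\<And>x. x \<in> cball 0 R \<Longrightarrow> \<bar>V x\<bar> \<le> F"
    using continuous_cball_bounded[OF continuous_V] by blast
  ultimately have V: "V \<in> borel_measurable \<mu>" "integrable \<mu> V"
    using sp by (auto intro!: \<mu>.integrable_const_bound[of _ F] AE_I2)
  then have Vh: "integrable \<mu> (\<lambda>x. V x + h)" by simp
  have pos: "0 \<le> V x + h" if "x \<in> cball 0 R" for x
    using V_nonneg[OF that] h by simp
  have fV: "integrable (lebesgue_ball R) (\<lambda>x. ?f x * (V x + h))"
    using f integrable_ball_mult[OF continuous_V f] by (simp add: algebra_simps)
  have "ennreal (LINT x|lebesgue_ball R. ?f x * (V x + h)) = (\<integral>\<^sup>+x. ennreal (?f x * (V x + h)) \<partial>lebesgue_ball R)"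
    using fV pos by (intro nn_integral_eq_integral[symmetric] AE_I2)
      (simp_all add: ac_density_def space_restrict_space)
  also have "\<dots> \<le> (\<integral>\<^sup>+x. ennreal (V x + h) \<partial>\<mu>)"
    using V(1) pos by (intro le) simp_all
  also have "\<dots> = ennreal (LINT x|\<mu>. V x + h)"
    using Vh pos sp by (intro nn_integral_eq_integral AE_I2) simp_all
  finally have "(LINT x|lebesgue_ball R. ?f x * (V x + h)) \<le> (LINT x|\<mu>. V x + h)"
    using pos sp by (subst (asm) ennreal_le_iff) (auto intro!: integral_nonneg_AE AE_I2)
  moreover have "(LINT x|lebesgue_ball R. ?f x * (V x + h))
      = (LINT x|lebesgue_ball R. V x * ?f x) + h * integral\<^sup>L (lebesgue_ball R) ?f"
    using f integrable_ball_mult[OF continuous_V f] by (simp add: distrib_left mult.commute)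
  moreover have "(LINT x|\<mu>. V x + h) = integral\<^sup>L \<mu> V + h * mass"
    using V tot by simp
  moreover have "F_relaxed m V R \<mu> = F_fun m V R ?f - (LINT x|lebesgue_ball R. V x * ?f x) + integral\<^sup>L \<mu> V"
    unfolding F_relaxed_def F_fun_eq set_integral_ball by simp
  ultimately show ?thesis
    using integral_gap[OF f f0] integral_gap_nonneg[OF f f0] by (simp add: algebra_simps)
qed

text \<open>The missing mass is spread evenly over a small ball around the origin, where
  \<open>V\<close> is below \<open>\<epsilon> / mass\<close>. This imitates the Dirac mass at a cost
  of at most \<epsilon>.\<close>

lemma F_fun_approx:
  assumes "0 < \<epsilon>"
  shows "\<exists>s\<in>mass_densities R mass. F_fun m V R s \<le> min_energy + \<epsilon>"
proof -
  interpret B: finite_measure "lebesgue_ball R :: 'a measure" by (rule finite_measure_lebesgue_ball)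
  have "0 \<in> cball 0 R" "0 < \<epsilon> / mass" using R assms mass by simp_all
  then obtain \<delta>0 where \<delta>0: "0 < \<delta>0"
    "\<And>x. x \<in> cball 0 R \<Longrightarrow> dist x 0 < \<delta>0 \<Longrightarrow> dist (V x) (V 0) < \<epsilon> / mass"
    using continuous_V unfolding continuous_on_iff by blast
  define \<delta> where "\<delta> = min \<delta>0 R"
  have \<delta>: "0 < \<delta>" "\<delta> \<le> R" using \<delta>0 R by (simp_all add: \<delta>_def)
  define S :: "'a set" where "S = ball 0 \<delta>"
  have SR: "S \<subseteq> ball 0 R" using \<delta> by (auto simp: S_def)
  have S: "S \<in> sets (lebesgue_ball R)" using SR by (simp add: sets_restrict_space_iff S_def)
  define c where "c = measure (lebesgue_ball R :: 'a measure) S"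
  have c: "0 < c"
    using content_ball_pos[OF \<delta>(1), of "0::'a"] SR
    by (simp add: c_def measure_restrict_space S_def)
  \<comment> \<open>The height at which the indicator of \<open>S\<close> carries exactly the
    missing mass.\<close>
  define k where "k = (mass - bulk_mass) / c"
  have k: "0 \<le> k" "k * c = mass - bulk_mass" using bulk_mass_bounds c by (simp_all add: k_def)
  define s where "s x = r x + k * indicator S x" for x
  have ind: "integrable (lebesgue_ball R) (\<lambda>x. indicator S x :: real)" "(LINT x|lebesgue_ball R. indicator S x) = c"
    using S sets.sets_into_space[OF S] by (simp_all add: c_def Int_absorb2 B.emeasure_finite less_top[symmetric])
  have s0: "r x \<le> s x" "0 \<le> s x" for x
    using k equilibrium_nonneg[of m "V x + h"] by (simp_all add: s_def)
  have si: "integrable (lebesgue_ball R) s"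
    unfolding s_def[abs_def] using ind(1) integrable_r by simp
  have "integral\<^sup>L (lebesgue_ball R) s = mass"
    unfolding s_def[abs_def] using ind integrable_r by (simp add: integral_r k)
  then have dens: "s \<in> mass_densities R mass"
    using si s0 by (simp add: mass_densities_iff)
  have AEs: "AE x in lebesgue_ball R. 0 \<le> s x" using s0 by simp
  \<comment> \<open>The power term enters the energy with a negative sign, so extra density lowers
    it and only the potential term can increase.\<close>
  have powr: "(LINT x|lebesgue_ball R. r x powr m) \<le> (LINT x|lebesgue_ball R. s x powr m)"
    using s0 m by (intro integral_mono integrable_powr[OF finite_measure_lebesgue_ball] si AEs
      integrable_r r_nonneg powr_mono2 equilibrium_nonneg) auto
  have Vind: "integrable (lebesgue_ball R) (\<lambda>x. V x * indicator S x)"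
    by (rule integrable_ball_mult[OF continuous_V ind(1)])
  have "(LINT x|lebesgue_ball R. V x * indicator S x) \<le> (LINT x|lebesgue_ball R. \<epsilon> / mass * indicator S x)"
  proof (rule integral_mono[OF Vind])
    show "integrable (lebesgue_ball R) (\<lambda>x. \<epsilon> / mass * indicator S x :: real)" using ind by simp
    fix x :: 'a
    show "V x * indicator S x \<le> \<epsilon> / mass * indicator S x"
    proof (cases "x \<in> S")
      case True
      then have "x \<in> cball 0 R" "dist x 0 < \<delta>0" using SR by (auto simp: S_def \<delta>_def)
      from \<delta>0(2)[OF this] True show ?thesis by (simp add: V_0 dist_real_def)
    qed simp
  qed
  then have "k * (LINT x|lebesgue_ball R. V x * indicator S x) \<le> k * (\<epsilon> / mass * c)"
    using k ind by (intro mult_left_mono) simp_all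
  also have "k * (\<epsilon> / mass * c) = \<epsilon> * ((mass - bulk_mass) / mass)"
    unfolding k(2)[symmetric] by (simp add: mult_ac)
  also have "\<dots> \<le> \<epsilon> * 1" using assms bulk_mass_bounds mass by (intro mult_left_mono) simp_all
  finally have small: "k * (LINT x|lebesgue_ball R. V x * indicator S x) \<le> \<epsilon>" by simp
  have "(LINT x|lebesgue_ball R. V x * s x)
      = (LINT x|lebesgue_ball R. V x * r x) + k * (LINT x|lebesgue_ball R. V x * indicator S x)"
  proof -
    have "V x * s x = V x * r x + k * (V x * indicator S x)" for x
      by (simp add: s_def algebra_simps)
    then show ?thesis
      using Vind integrable_ball_mult[OF continuous_V integrable_r] by simp
  qed
  moreover have "- (1 / (1 - m)) * (LINT x|lebesgue_ball R. s x powr m)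
      \<le> - (1 / (1 - m)) * (LINT x|lebesgue_ball R. r x powr m)"
    using powr m by (intro mult_left_mono_neg) simp_all
  ultimately have "F_fun m V R s \<le> min_energy + \<epsilon>"
    using small unfolding F_fun_eq min_energy_def by linarith
  with dens show ?thesis by blast
qed

lemma INF_F_fun: "(INF \<eta>\<in>mass_densities R mass. ereal (F_fun m V R \<eta>)) = ereal min_energy"
proof (rule antisym)
  show "ereal min_energy \<le> (INF \<eta>\<in>mass_densities R mass. ereal (F_fun m V R \<eta>))"
    by (intro INF_greatest) (simp add: F_fun_ge)
  show "(INF \<eta>\<in>mass_densities R mass. ereal (F_fun m V R \<eta>)) \<le> ereal min_energy"
  proof (rule ereal_le_epsilon2)
    fix \<epsilon> :: real assume "0 < \<epsilon>"
    from F_fun_approx[OF this] obtain s where "s \<in> mass_densities R mass" "F_fun m V R s \<le> min_energy + \<epsilon>"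
      by blast
    then show "(INF \<eta>\<in>mass_densities R mass. ereal (F_fun m V R \<eta>)) \<le> ereal min_energy + ereal \<epsilon>"
      by (intro INF_lower2) simp_all
  qed
qed

lemma INF_F_relaxed: "(INF \<mu>\<in>mass_measures R mass. ereal (F_relaxed m V R \<mu>)) = ereal min_energy"
proof (rule antisym)
  show "ereal min_energy \<le> (INF \<mu>\<in>mass_measures R mass. ereal (F_relaxed m V R \<mu>))"
    by (intro INF_greatest) (simp add: F_relaxed_ge)
  show "(INF \<mu>\<in>mass_measures R mass. ereal (F_relaxed m V R \<mu>)) \<le> ereal min_energy"
    using INF_lower[OF \<mu>0_mass, of "\<lambda>\<mu>. ereal (F_relaxed m V R \<mu>)"] by (simp add: F_relaxed_\<mu>0)
qed

text \<open>If the mass is attained, \<open>h\<close> is the unique such value and the Dirac weight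
  in \<open>\<mu>0\<close> is 0. Otherwise \<open>h = 0\<close>, the mass there is too small, and
  any larger value would give still less, so the second branch applies.\<close>

lemma mu_inf_eq: "mu_inf m V R mass = \<mu>0"
proof (cases "a_mass m V R h = ennreal mass")
  case True
  have "(THE h. 0 \<le> h \<and> a_mass m V R h = ennreal mass) = h"
  proof (rule the_equality)
    fix h' assume "0 \<le> h' \<and> a_mass m V R h' = ennreal mass"
    then show "h' = h" using True h by (intro a_mass_inj) auto
  qed (use True h in simp)
  then have "mu_inf m V R mass = density_measure R (rho m V h)"
    using True h by (auto simp: mu_inf_def)
  also have "\<dots> = \<mu>0"
    unfolding \<mu>0_def by (rule measure_eqI) (simp_all add: True emeasure_add_measure)
  finally show ?thesis .
next
  case False
  then have less: "a_mass m V R h < ennreal mass" and h0: "h = 0"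
    using a_mass_le h_or by auto
  have none: "\<not> (\<exists>h\<ge>0. a_mass m V R h = ennreal mass)"
  proof
    assume "\<exists>h\<ge>0. a_mass m V R h = ennreal mass"
    then obtain h' where h': "0 \<le> h'" "a_mass m V R h' = ennreal mass" by blast
    then have "h < h'" using False h0 by (cases "h' = 0") auto
    then have "a_mass m V R h' < a_mass m V R h"
      using h a_mass_fin by (intro a_mass_strict_antimono)
    with less h' show False by simp
  qed
  show ?thesis
    unfolding mu_inf_def if_not_P[OF none] \<mu>0_def using less h0 by simp
qed

end

theorem theorem6p1:
  fixes V :: "'a::euclidean_space \<Rightarrow> real" and m R mass :: real
  assumes "0 < m" "m < 1" "0 < R" "0 < mass"
    and "sobolev_inf 2 (ball 0 R) V"
    and "continuous_on (cball 0 R) V"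
    and "radially_increasing R V"
    and "V 0 = 0"
  shows "(\<forall>\<rho> :: nat \<Rightarrow> 'a \<Rightarrow> real.
            (\<forall>j. \<rho> j \<in> mass_densities R mass) \<and>
            (\<lambda>j. ereal (F_fun m V R (\<rho> j)))
              \<longlonglongrightarrow> (INF \<eta>\<in>mass_densities R mass. ereal (F_fun m V R \<eta>)) \<longrightarrow>
            weak_star_conv R (\<lambda>j. density_measure R (\<lambda>x. ennreal (\<rho> j x))) (mu_inf m V R mass))
       \<and> ereal (F_relaxed m V R (mu_inf m V R mass))
           = (INF \<mu>\<in>mass_measures R mass. ereal (F_relaxed m V R \<mu>))
       \<and> (INF \<mu>\<in>mass_measures R mass. ereal (F_relaxed m V R \<mu>))
           = (INF \<eta>\<in>mass_densities R mass. ereal (F_fun m V R \<eta>))"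
proof -
  interpret radial_potential m R V
    by unfold_locales (use assms in auto)
  obtain h where "0 \<le> h" "a_mass m V R h \<le> ennreal mass" "h = 0 \<or> a_mass m V R h = ennreal mass"
    using equilibrium_exists[OF assms(4)] by blast
  \<comment> \<open>With this \<open>h\<close> fixed, the two cases of \<open>mu_inf\<close> need no
    further distinction.\<close>
  then interpret equilibrium_state m R V mass h
    by unfold_locales (use assms in auto)
  have "weak_star_conv R (\<lambda>j. density_measure R (\<lambda>x. ennreal (\<rho> j x))) \<mu>0"
    if \<rho>: "\<And>j. \<rho> j \<in> mass_densities R mass"
      and lim: "(\<lambda>j. ereal (F_fun m V R (\<rho> j))) \<longlonglongrightarrow> ereal min_energy"
    for \<rho> :: "nat \<Rightarrow> 'a \<Rightarrow> real"
    unfolding weak_star_conv_def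
  proof (intro allI impI)
    fix f :: "'a \<Rightarrow> real" assume f: "continuous_on (cball 0 R) f"
    have "integral\<^sup>L (density_measure R (\<lambda>x. ennreal (\<rho> j x))) f = (LINT x|lebesgue_ball R. \<rho> j x * f x)" for j
      using mass_densitiesD(1,2)[OF \<rho>]
      by (intro integral_density_measure continuous_measurable_cball[OF f] borel_measurable_integrable)
    then show "(\<lambda>j. integral\<^sup>L (density_measure R (\<lambda>x. ennreal (\<rho> j x))) f) \<longlonglongrightarrow> integral\<^sup>L \<mu>0 f"
      using test_integral_tendsto[OF \<rho> _ f] lim by (simp add: integral_\<mu>0[OF f])
  qed
  then show ?thesis
    unfolding mu_inf_eq INF_F_fun INF_F_relaxed F_relaxed_\<mu>0 by blast
qed

end
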